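(* Consider the single-queue bandit and the algorithm Q-ThS described in the context, with any problem instance $(\lambda,\boldsymbol\mu)$. Let $$w(t)=\exp\left(\left(\frac{2\log t}{\Delta}\right)^{2/3}\right),\quad v'(t)=\frac{6K}{\epsilon}w(t),\quad v(t)=\frac{24}{\epsilon^2}\log t+\frac{60K}{\epsilon}\frac{v'(t)\log^2 t}{t}.$$ Then there exist constants $C>0$ and $t_0$, not depending on $K$ or $\epsilon$, such that under Q-ThS $$\Psi(t)\le C\,\frac{K\,v(t)\log^2 t}{t}$$ for all $t>t_0$ satisfying $\frac{w(t)}{\log t}\ge\frac{2}{\epsilon}$, $t\ge\exp(6/\Delta^2)$ and $v(t)+v'(t)\le t/2$.
   Context: Discrete-time queueing system with one queue and $K\ge 2$ servers indexed by $[K]$. Arrivals $A(t)\in\{0,1\}$ are i.i.d. Bernoulli($\lambda$); the service $R_k(t)\in\{0,1\}$ of server $k$ at time $t$ is Bernoulli($\mu_k$), independent across $k$, $t$ and of the arrivals. $\mu^*=\max_k\mu_k$ is attained at a unique server $k^*$ and $\lambda<\mu^*$. A policy chooses $\kappa(t)\in[K]$ based on past observations; $S(t)=R_{\kappa(t)}(t)$ and $Q(t)=(Q(t-1)+A(t)-S(t))^+$. The genie queue $Q^*(t)=(Q^*(t-1)+A(t)-R_{k^*}(t))^+$ uses the same arrivals. $Q(0)$ and $Q^*(0)$ are both distributed according to the stationary distribution of $Q^*$. Queue-regret: $\Psi(t)=\mathbb{E}[Q(t)-Q^*(t)]$. Let $\epsilon=\mu^*-\lambda$ and $\Delta=\mu^*-\max_{k\ne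 k^*}\mu_k$. Algorithm Q-ThS: let $T_k(t)$ be the number of slots in $\{1,\dots,t\}$ in which server $k$ was scheduled, and $\hat\mu_k(t)$ the empirical mean of the services observed from server $k$ before time $t$. At time $t$, draw an independent Bernoulli variable $\mathsf E(t)$ with mean $\min\{1,3K\log^2 t/t\}$. If $\mathsf E(t)=1$ (explore), schedule a server chosen uniformly at random. Otherwise (exploit), for each $k$ draw independently $\hat\theta_k(t)\sim\mathrm{Beta}(\hat\mu_k(t)T_k(t-1)+1,(1-\hat\mu_k(t))T_k(t-1)+1)$ and schedule $\kappa(t)\in\arg\max_k\hat\theta_k(t)$. *)

theory Defs
  imports "HOL-Probability.Probability"
begin

definition beta_density :: "real \<Rightarrow> real \<Rightarrow> real \<Rightarrow> ennreal" where
  "beta_density a b x =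
     (if 0 < x \<and> x < 1 then ennreal (x powr (a - 1) * (1 - x) powr (b - 1) / Beta a b) else 0)"

definition beta_measure :: "real \<Rightarrow> real \<Rightarrow> real measure" where
  "beta_measure a b = density lborel (beta_density a b)"

abbreviation bern :: "real \<Rightarrow> bool measure" where
  "bern p \<equiv> measure_pmf (bernoulli_pmf p)"

(* argmax over servers {1..K}; ties (a null event) broken towards the smallest index *)
definition argmax_idx :: "nat \<Rightarrow> (nat \<Rightarrow> real) \<Rightarrow> nat" where
  "argmax_idx K \<theta> = (LEAST k. k \<in> {1..K} \<and> (\<forall>j\<in>{1..K}. \<theta> j \<le> \<theta> k))"

(* State of the system at the end of a slot:
   (Q, Q*, S, F) where S k / F k = number of observed successes / failures of server k
   so far; T_k = S k + F k and \<mu>hat_k T_k = S k. *)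
type_synonym qstate = "nat \<times> nat \<times> (nat \<Rightarrow> nat) \<times> (nat \<Rightarrow> nat)"

definition explore_prob :: "nat \<Rightarrow> nat \<Rightarrow> real" where
  "explore_prob K t = min 1 (3 * real K * (ln (real t))\<^sup>2 / real t)"

definition ts_choice :: "nat \<Rightarrow> (nat \<Rightarrow> nat) \<Rightarrow> (nat \<Rightarrow> nat) \<Rightarrow> nat measure" where
  "ts_choice K S F =
     distr (PiM {1..K} (\<lambda>k. beta_measure (real (S k) + 1) (real (F k) + 1)))
           (count_space UNIV) (argmax_idx K)"

definition qths_step ::
  "nat \<Rightarrow> real \<Rightarrow> (nat \<Rightarrow> real) \<Rightarrow> nat \<Rightarrow> nat \<Rightarrow> qstate \<Rightarrow> qstate measure" where
  "qths_step K lam \<mu> kstar t s =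
     (case s of (q, qs, S, F) \<Rightarrow>
       bind (bern lam) (\<lambda>A.
       bind (PiM {1..K} (\<lambda>k. bern (\<mu> k))) (\<lambda>R.
       bind (bern (explore_prob K t)) (\<lambda>E.
       bind (if E then measure_pmf (pmf_of_set {1..K}) else ts_choice K S F) (\<lambda>\<kappa>.
       return (count_space UNIV)
         ((q + of_bool A) - of_bool (R \<kappa>),
          (qs + of_bool A) - of_bool (R kstar),
          S(\<kappa> := S \<kappa> + of_bool (R \<kappa>)),
          F(\<kappa> := F \<kappa> + of_bool (\<not> R \<kappa>))))))))"

primrec qths_dist ::
  "nat \<Rightarrow> real \<Rightarrow> (nat \<Rightarrow> real) \<Rightarrow> nat \<Rightarrow> nat pmf \<Rightarrow> nat \<Rightarrow> qstate measure" where
  "qths_dist K lam \<mu> kstar \<pi> 0 =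
     distr (measure_pmf \<pi>) (count_space UNIV) (\<lambda>q. (q, q, \<lambda>_. 0, \<lambda>_. 0))"
| "qths_dist K lam \<mu> kstar \<pi> (Suc t) =
     bind (qths_dist K lam \<mu> kstar \<pi> t) (qths_step K lam \<mu> kstar (Suc t))"

definition queue_regret ::
  "nat \<Rightarrow> real \<Rightarrow> (nat \<Rightarrow> real) \<Rightarrow> nat \<Rightarrow> nat pmf \<Rightarrow> nat \<Rightarrow> real" where
  "queue_regret K lam \<mu> kstar \<pi> t =
     integral\<^sup>L (qths_dist K lam \<mu> kstar \<pi> t) (\<lambda>s. real (fst s) - real (fst (snd s)))"

(* stationarity of \<pi> for the genie queue Q*(t) = (Q*(t-1) + A(t) - R_{k*}(t))^+ *)
definition genie_stationary :: "real \<Rightarrow> real \<Rightarrow> nat pmf \<Rightarrow> bool" where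
  "genie_stationary lam mustar \<pi> \<longleftrightarrow>
     bind_pmf \<pi> (\<lambda>q. bind_pmf (bernoulli_pmf lam) (\<lambda>a.
        map_pmf (\<lambda>r. (q + of_bool a) - of_bool r) (bernoulli_pmf mustar))) = \<pi>"

definition w_fun :: "real \<Rightarrow> real \<Rightarrow> real" where
  "w_fun \<Delta> t = exp ((2 * ln t / \<Delta>) powr (2/3))"

definition v'_fun :: "nat \<Rightarrow> real \<Rightarrow> real \<Rightarrow> real \<Rightarrow> real" where
  "v'_fun K \<epsilon> \<Delta> t = 6 * real K / \<epsilon> * w_fun \<Delta> t"

definition v_fun :: "nat \<Rightarrow> real \<Rightarrow> real \<Rightarrow> real \<Rightarrow> real" where
  "v_fun K \<epsilon> \<Delta> t = 24 / \<epsilon>\<^sup>2 * ln t + 60 * real K / \<epsilon> * (v'_fun K \<epsilon> \<Delta> t * (ln t)\<^sup>2 / t)"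

end

theory Submission
  imports Defs "HOL-Probability.Hoeffding" "HOL-Real_Asymp.Real_Asymp"
begin

text \<open>The queue exceeds the genie queue by at most the number of suboptimal choices since it was last
  empty: when it is empty it does not exceed the genie queue, and when both are served by the best
  server the excess does not grow. So it suffices that the queue empties during the last
  $O(\log t/\epsilon^2)$ slots except with probability $O(t^{-2})$, since there suboptimal choices
  have probability $O(K\log^2 t/t)$.

  Forced exploration gives every server at least a constant times $\log^2 t/\Delta^2$ samples by time
  $O(K\sqrt{w(t)})$. From then on exponential supermartingales for the empirical means, together
  with a Hoeffding bound for the Beta distribution, make a wrong exploitation choice
  superpolynomially unlikely. On these paths the moment $E\,e^{\epsilon Q}$ contracts by
  $e^{-3\epsilon^2/4}$ in each slot, up to a factor accounting for exploration, as long as the queue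
  is not empty; this empties the queue.\<close>

section \<open>Thompson sampling choices\<close>

text \<open>Learning and queueing cannot be separated: the services that train the sampler also
  drain the queue. All estimates are therefore one-step bounds conditional on the whole state,
  multiplied along the chain. The exponent epsilon balances drift and fluctuation. Hoeffding's lemma
  costs epsilon^2/8 each for arrival and service against a drift of -epsilon^2, leaving -3/4
  epsilon^2. A wrong choice of conditional probability p costs a factor of at most exp(2 epsilon p),
  so p \<le> epsilon/8 still leaves the rate epsilon^2/2. The learning time g, of order K sqrt(w),
  may inflate the moment by exp(epsilon g), and later exploration by exp(O(epsilon K log^3 t)). The
  bound v' \<le> t/2 says that K w is at most epsilon t/12, so a drain over a constant fraction of
  t, worth exp(-epsilon^2 t/10), repays both. The constants are free of the instance because the
  number of samples n0 is proportional to log^2 t / \<Delta>^2: in the failure exponents the gap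
  cancels or only helps, so failures fall below a high power of 1/t that absorbs K and 1/\<Delta>^2,
  both O(t).\<close>

lemma beta_const_eq:
  "1 / Beta (real a + 1) (real b + 1) = real (a + b + 1) * real ((a + b) choose a)"
proof -
  have *: "Gamma (1 + real n) = fact n" for n
    using Gamma_fact[of n, where 'a = real] by simp
  have "Beta (real a + 1) (real b + 1) = fact a * fact b / fact (a + b + 1)"
    using *[of a] *[of b] *[of "a + b + 1"] by (simp add: Beta_def add_ac)
  moreover have "real ((a + b) choose a) = fact (a + b) / (fact a * fact b)"
    using binomial_fact[of a "a + b", where 'a = real] by simp
  moreover have "(fact (a + b + 1) :: real) = real (a + b + 1) * fact (a + b)"
    by (simp add: algebra_simps)
  ultimately show ?thesis by simp
qed

lemma beta_density_eq_binomial: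
  assumes "0 < x" "x < 1"
  shows "beta_density (real a + 1) (real b + 1) x
           = ennreal (real (a + b + 1) * pmf (binomial_pmf (a + b) x) a)"
proof -
  have "x powr real a * (1 - x) powr real b / Beta (real a + 1) (real b + 1)
      = (x ^ a * (1 - x) ^ b) * (1 / Beta (real a + 1) (real b + 1))"
    using assms by (simp add: powr_realpow)
  also have "\<dots> = real (a + b + 1) * pmf (binomial_pmf (a + b) x) a"
    unfolding beta_const_eq using assms by (simp add: mult_ac)
  finally show ?thesis using assms by (simp add: beta_density_def)
qed

lemma beta_density_measurable [measurable]: "beta_density a b \<in> borel_measurable borel"
  unfolding beta_density_def by measurable

lemma sets_beta_measure [simp, measurable_cong]: "sets (beta_measure a b) = sets borel"
  by (simp add: beta_measure_def)

lemma space_beta_measure [simp]: "space (beta_measure a b) = UNIV"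
  by (simp add: beta_measure_def)

lemma prob_space_beta_measure:
  assumes "a > 0" "b > 0"
  shows "prob_space (beta_measure a b)"
proof
  define f where "f = (\<lambda>x::real. x powr (a - 1) * (1 - x) powr (b - 1) / Beta a b)"
  have B: "Beta a b > 0"
    using assms by (simp add: Beta_def Gamma_real_pos)
  have "((\<lambda>x. x powr (a - 1) * (1 - x) powr (b - 1)) has_integral Beta a b) {0<..<1}"
    using has_integral_Beta_real[OF assms] by (simp add: has_integral_Icc_iff_Ioo)
  from has_integral_divide[OF this, of "Beta a b"] B
  have "(f has_integral 1) {0<..<1}" by (simp add: f_def)
  then have "(\<integral>\<^sup>+x. ennreal (indicat_real {0<..<1} x * f x) \<partial>lborel) = ennreal 1"
    using B by (intro nn_integral_has_integral_lebesgue) (auto simp: f_def)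
  moreover have "(\<integral>\<^sup>+x. beta_density a b x \<partial>lborel)
      = (\<integral>\<^sup>+x. ennreal (indicat_real {0<..<1} x * f x) \<partial>lborel)"
    by (intro nn_integral_cong) (auto simp: beta_density_def f_def indicator_def)
  ultimately show "emeasure (beta_measure a b) (space (beta_measure a b)) = 1"
    by (simp add: beta_measure_def emeasure_density)
qed

text \<open>The density of the Beta distribution with parameters $a+1$, $b+1$ at $x$ is $a+b+1$ times the
  probability that a binomial variable with parameters $a+b$, $x$ equals $a$; this transfers
  Hoeffding's inequality to the Beta distribution.\<close>

lemma beta_measure_tail:
  assumes n: "a + b > 0" and d: "d \<ge> 0"
  shows "emeasure (beta_measure (real a + 1) (real b + 1)) {x. \<bar>x - real a / real (a + b)\<bar> \<ge> d}
          \<le> ennreal (2 * real (a + b + 1) * exp (- 2 * real (a + b) * d\<^sup>2))"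
proof -
  let ?c = "2 * real (a + b + 1) * exp (- 2 * real (a + b) * d\<^sup>2)"
  have pw: "beta_density (real a + 1) (real b + 1) x * indicator {x. \<bar>x - real a / real (a + b)\<bar> \<ge> d} x
      \<le> ennreal ?c * indicator {0<..<1} x" for x
  proof (cases "0 < x \<and> x < 1 \<and> \<bar>x - real a / real (a + b)\<bar> \<ge> d")
    case True
    then interpret binomial_distribution "a + b" x by unfold_locales auto
    \<comment> \<open>The point \<open>a\<close> itself lies in the deviation event, since
      \<open>x\<close> is at least \<open>d\<close> away from \<open>a / (a + b)\<close>; so its
      single weight is at most the binomial tail.\<close>
    have "pmf (binomial_pmf (a + b) x) a
        \<le> measure_pmf.prob (binomial_pmf (a + b) x) {y. \<bar>real y / real (a + b) - x\<bar> \<ge> d}"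
      unfolding measure_pmf_single[symmetric]
      by (rule measure_pmf.finite_measure_mono) (use True in auto)
    also have "\<dots> \<le> 2 * exp (- 2 * real (a + b) * d\<^sup>2)"
      using prob_abs_ge'[OF n d] by simp
    finally have "real (a + b + 1) * pmf (binomial_pmf (a + b) x) a \<le> real (a + b + 1) * (2 * exp (- 2 * real (a + b) * d\<^sup>2))"
      by (rule mult_left_mono) simp
    also have "\<dots> = ?c" by simp
    finally show ?thesis using True by (auto simp: beta_density_eq_binomial intro!: ennreal_leI)
  qed (auto simp: beta_density_def indicator_def)
  have "emeasure (beta_measure (real a + 1) (real b + 1)) {x. \<bar>x - real a / real (a + b)\<bar> \<ge> d}
     = (\<integral>\<^sup>+x. beta_density (real a + 1) (real b + 1) x * indicator {x. \<bar>x - real a / real (a + b)\<bar> \<ge> d} x \<partial>lborel)"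
    unfolding beta_measure_def by (intro emeasure_density) auto
  also have "\<dots> \<le> (\<integral>\<^sup>+x. ennreal ?c * indicator {0<..<1::real} x \<partial>lborel)"
    by (rule nn_integral_mono) (rule pw)
  also have "\<dots> = ennreal ?c"
    by (subst nn_integral_cmult_indicator) auto
  finally show ?thesis .
qed

section \<open>The law of the server with the largest sample\<close>

lemma argmax_idx_props:
  assumes "K \<ge> 1"
  shows "argmax_idx K \<theta> \<in> {1..K}" "j \<in> {1..K} \<Longrightarrow> \<theta> j \<le> \<theta> (argmax_idx K \<theta>)"
proof -
  have "Max (\<theta> ` {1..K}) \<in> \<theta> ` {1..K}" using assms by (intro Max_in) auto
  then obtain k where k: "k \<in> {1..K}" "\<theta> k = Max (\<theta> ` {1..K})" by auto
  then have "k \<in> {1..K} \<and> (\<forall>j\<in>{1..K}. \<theta> j \<le> \<theta> k)" by auto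
  from LeastI[of "\<lambda>k. k \<in> {1..K} \<and> (\<forall>j\<in>{1..K}. \<theta> j \<le> \<theta> k)", OF this]
  show "argmax_idx K \<theta> \<in> {1..K}" "j \<in> {1..K} \<Longrightarrow> \<theta> j \<le> \<theta> (argmax_idx K \<theta>)"
    unfolding argmax_idx_def by auto
qed

lemma argmax_idx_measurable [measurable]:
  "argmax_idx K \<in> measurable (PiM {1..K} (\<lambda>_. borel)) (count_space UNIV)"
  unfolding argmax_idx_def
proof (rule measurable_Least)
  fix i
  show "Measurable.pred (Pi\<^sub>M {1..K} (\<lambda>_. borel :: real measure))
     (\<lambda>x. i \<in> {1..K} \<and> (\<forall>j\<in>{1..K}. x j \<le> x i))"
  proof (cases "i \<in> {1..K}")
    case True
    let ?M = "Pi\<^sub>M {1..K} (\<lambda>_. borel :: real measure)"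
    have *: "Measurable.pred ?M (\<lambda>x. x j \<le> x i)" if "j \<in> {1..K}" for j
    proof -
      have "(\<lambda>x. x j) \<in> borel_measurable ?M" "(\<lambda>x. x i) \<in> borel_measurable ?M"
        by (rule measurable_component_singleton, fact)+
      from borel_measurable_le[OF this] show ?thesis by (simp only: Measurable.pred_def)
    qed
    have "Measurable.pred ?M (\<lambda>x. \<forall>j\<in>{1..K}. x j \<le> x i)"
      by (rule pred_intros_finite(3)) (use * in auto)
    then show ?thesis using True by (simp only: simp_thms)
  next
    case False
    then have "(\<lambda>x. i \<in> {1..K} \<and> (\<forall>j\<in>{1..K}. x j \<le> x i)) = (\<lambda>x :: nat \<Rightarrow> real. False)" by blast
    then show ?thesis by (simp only: measurable_const space_count_space UNIV_I)
  qed
qed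

lemma sets_PiM_beta:
  "sets (PiM I (\<lambda>k. beta_measure (f k) (g k))) = sets (PiM I (\<lambda>_. borel))"
  by (intro sets_PiM_cong) auto

lemma argmax_idx_measurable_beta:
  "argmax_idx K \<in> measurable (PiM {1..K} (\<lambda>k. beta_measure (f k) (g k))) (count_space UNIV)"
  using argmax_idx_measurable[of K] measurable_cong_sets[OF sets_PiM_beta refl] by blast

lemma prob_space_PiM_beta:
  "prob_space (PiM I (\<lambda>k. beta_measure (real (f k) + 1) (real (g k) + 1)))"
  by (intro prob_space_PiM prob_space_beta_measure) auto

lemma prob_space_ts_choice: "prob_space (ts_choice K S F)"
  unfolding ts_choice_def
  by (intro prob_space.prob_space_distr prob_space_PiM_beta argmax_idx_measurable_beta)

text \<open>This is the condition for a probability measure to be a \<open>pmf\<close>. On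
  \<open>nat\<close> it is automatic: the points of mass zero form a countable union of null
  sets.\<close>

lemma AE_atoms_nat:
  fixes M :: "nat measure"
  assumes "prob_space M" "sets M = UNIV"
  shows "AE x in M. measure M {x} \<noteq> 0"
proof -
  interpret prob_space M by fact
  have "emeasure M {x} = ennreal (measure M {x})" for x by (rule emeasure_eq_measure)
  then have "(\<Union>x\<in>{x. measure M {x} = 0}. {x}) \<in> null_sets M"
    by (intro null_sets_UN') (auto simp: assms)
  then have N: "{x. measure M {x} = 0} \<in> null_sets M" by simp
  show ?thesis
    by (rule AE_I'[OF N]) auto
qed

text \<open>The Beta samples are continuous, but only the index of the largest one enters the
  dynamics. Taking its law as a \<open>pmf\<close> makes the whole chain discrete, and measurability
  obligations vanish from here on.\<close>

definition ts_pmf :: "nat \<Rightarrow> (nat \<Rightarrow> nat) \<Rightarrow> (nat \<Rightarrow> nat) \<Rightarrow> nat pmf" where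
  "ts_pmf K S F = Abs_pmf (ts_choice K S F)"

lemma measure_ts_pmf: "measure_pmf (ts_pmf K S F) = ts_choice K S F"
proof -
  have "sets (ts_choice K S F) = UNIV" by (simp add: ts_choice_def)
  then show ?thesis
    unfolding ts_pmf_def using prob_space_ts_choice AE_atoms_nat
    by (intro Abs_pmf_inverse) auto
qed

lemma set_ts_pmf:
  assumes "K \<ge> 1"
  shows "set_pmf (ts_pmf K S F) \<subseteq> {1..K}"
proof -
  have "AE x in ts_choice K S F. x \<in> {1..K}"
    unfolding ts_choice_def using argmax_idx_props(1)[OF assms]
    by (subst AE_distr_iff[OF argmax_idx_measurable_beta]) auto
  then have "AE x in measure_pmf (ts_pmf K S F). x \<in> {1..K}" by (subst measure_ts_pmf)
  then show ?thesis by (auto simp: AE_measure_pmf_iff)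
qed

text \<open>If every sample is strictly within \<open>d\<close> of its empirical mean, and every
  empirical mean within \<open>d\<close> of the true one, then samples are strictly within
  \<open>2 * d\<close> of the truth and a gap of \<open>4 * d\<close> makes \<open>ks\<close> the
  unique maximiser. A wrong choice thus forces some sample to deviate by \<open>d\<close>; a union
  bound over the servers and the Beta tail finish.\<close>

lemma ts_pmf_wrong:
  assumes K: "K \<ge> 1" and ks: "ks \<in> {1..K}" and d: "d > 0"
    and gap: "\<And>k. k \<in> {1..K} \<Longrightarrow> k \<noteq> ks \<Longrightarrow> \<mu> k + 4 * d \<le> \<mu> ks"
    and pos: "\<And>k. k \<in> {1..K} \<Longrightarrow> S k + F k > 0"
    and conc: "\<And>k. k \<in> {1..K} \<Longrightarrow> \<bar>real (S k) - \<mu> k * real (S k + F k)\<bar> \<le> d * real (S k + F k)"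
  shows "emeasure (measure_pmf (ts_pmf K S F)) (- {ks})
     \<le> ennreal (\<Sum>k\<in>{1..K}. 2 * real (S k + F k + 1) * exp (- 2 * real (S k + F k) * d\<^sup>2))"
proof -
  define P where "P = PiM {1..K} (\<lambda>k. beta_measure (real (S k) + 1) (real (F k) + 1))"
  define B where "B k = {x. \<bar>x - real (S k) / real (S k + F k)\<bar> \<ge> d}" for k
  have B [measurable]: "B k \<in> sets borel" for k unfolding B_def by measurable
  interpret P: prob_space P unfolding P_def by (rule prob_space_PiM_beta)
  have [measurable_cong]: "sets P = sets (PiM {1..K} (\<lambda>_. borel))"
    unfolding P_def by (rule sets_PiM_beta)
  have mB: "{\<theta> \<in> space P. \<theta> k \<in> B k} \<in> sets P" if "k \<in> {1..K}" for k
    using that by measurable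
  have "emeasure (measure_pmf (ts_pmf K S F)) (- {ks}) = emeasure P (argmax_idx K -` (- {ks}) \<inter> space P)"
    unfolding measure_ts_pmf ts_choice_def P_def
    by (intro emeasure_distr argmax_idx_measurable_beta) auto
  also have "\<dots> \<le> emeasure P (\<Union>k\<in>{1..K}. {\<theta> \<in> space P. \<theta> k \<in> B k})"
  proof (rule emeasure_mono)
    show "argmax_idx K -` (- {ks}) \<inter> space P \<subseteq> (\<Union>k\<in>{1..K}. {\<theta> \<in> space P. \<theta> k \<in> B k})"
    proof (rule subsetI, rule ccontr)
      fix \<theta> assume a: "\<theta> \<in> argmax_idx K -` (- {ks}) \<inter> space P"
        and n: "\<theta> \<notin> (\<Union>k\<in>{1..K}. {\<theta> \<in> space P. \<theta> k \<in> B k})"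
      have close: "\<bar>\<theta> k - \<mu> k\<bar> < 2 * d" if k: "k \<in> {1..K}" for k
      proof -
        have 1: "\<bar>\<theta> k - real (S k) / real (S k + F k)\<bar> < d" using a n k by (force simp: B_def not_le)
        have p: "0 < real (S k + F k)" using pos[OF k] by linarith
        have "\<bar>real (S k) / real (S k + F k) - \<mu> k\<bar> = \<bar>real (S k) - \<mu> k * real (S k + F k)\<bar> / real (S k + F k)"
          using p by (simp add: abs_divide field_simps)
        also have "\<dots> \<le> d" using conc[OF k] p by (simp add: divide_le_eq)
        finally show ?thesis using 1 by linarith
      qed
      let ?j = "argmax_idx K \<theta>"
      have j: "?j \<in> {1..K}" "?j \<noteq> ks" "\<theta> ks \<le> \<theta> ?j"
        using argmax_idx_props[OF K] ks a by auto
      from close[OF j(1)] close[OF ks] gap[OF j(1,2)] j(3) show False by linarith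
    qed
    show "(\<Union>k\<in>{1..K}. {\<theta> \<in> space P. \<theta> k \<in> B k}) \<in> sets P" using mB by (intro sets.finite_UN) auto
  qed
  also have "\<dots> \<le> (\<Sum>k\<in>{1..K}. emeasure P {\<theta> \<in> space P. \<theta> k \<in> B k})"
    using mB by (intro emeasure_subadditive_finite) auto
  also have "\<dots> = (\<Sum>k\<in>{1..K}. emeasure (beta_measure (real (S k) + 1) (real (F k) + 1)) (B k))"
  proof (rule sum.cong[OF refl])
    fix k assume k: "k \<in> {1..K}"
    have "emeasure (beta_measure (real (S k) + 1) (real (F k) + 1)) (B k)
       = emeasure (distr P (beta_measure (real (S k) + 1) (real (F k) + 1)) (\<lambda>\<theta>. \<theta> k)) (B k)"
      unfolding P_def using k
      by (subst distr_PiM_component) (auto intro: prob_space_beta_measure)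
    also have "\<dots> = emeasure P ((\<lambda>\<theta>. \<theta> k) -` B k \<inter> space P)"
      using k unfolding P_def by (intro emeasure_distr measurable_component_singleton) auto
    also have "(\<lambda>\<theta>. \<theta> k) -` B k \<inter> space P = {\<theta> \<in> space P. \<theta> k \<in> B k}" by auto
    finally show "emeasure P {\<theta> \<in> space P. \<theta> k \<in> B k}
      = emeasure (beta_measure (real (S k) + 1) (real (F k) + 1)) (B k)" by simp
  qed
  also have "\<dots> \<le> (\<Sum>k\<in>{1..K}. ennreal (2 * real (S k + F k + 1) * exp (- 2 * real (S k + F k) * d\<^sup>2)))"
    unfolding B_def using pos d by (intro sum_mono beta_measure_tail) auto
  also have "\<dots> = ennreal (\<Sum>k\<in>{1..K}. 2 * real (S k + F k + 1) * exp (- 2 * real (S k + F k) * d\<^sup>2))"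
    by (rule sum_ennreal) auto
  finally show ?thesis .
qed

section \<open>The system as a discrete Markov chain\<close>

definition choice_pmf :: "nat \<Rightarrow> nat \<Rightarrow> (nat \<Rightarrow> nat) \<Rightarrow> (nat \<Rightarrow> nat) \<Rightarrow> nat pmf" where
  "choice_pmf K t S F = bind_pmf (bernoulli_pmf (explore_prob K t))
     (\<lambda>E. if E then pmf_of_set {1..K} else ts_pmf K S F)"

text \<open>The choice is drawn first here, whereas \<open>qths_step\<close> draws it last, because
  every one-step estimate conditions on the server chosen. The value \<open>False\<close> is the
  default that \<open>Pi_pmf\<close> requires outside \<open>{1..K}\<close>.\<close>

definition step_pmf ::
  "nat \<Rightarrow> real \<Rightarrow> (nat \<Rightarrow> real) \<Rightarrow> nat \<Rightarrow> nat \<Rightarrow> qstate \<Rightarrow> qstate pmf" where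
  "step_pmf K lam \<mu> kstar t s = (case s of (q, qs, S, F) \<Rightarrow>
     bind_pmf (choice_pmf K t S F) (\<lambda>\<kappa>.
     bind_pmf (bernoulli_pmf lam) (\<lambda>A.
     bind_pmf (Pi_pmf {1..K} False (\<lambda>k. bernoulli_pmf (\<mu> k))) (\<lambda>R.
     return_pmf
         ((q + of_bool A) - of_bool (R \<kappa>),
          (qs + of_bool A) - of_bool (R kstar),
          S(\<kappa> := S \<kappa> + of_bool (R \<kappa>)),
          F(\<kappa> := F \<kappa> + of_bool (\<not> R \<kappa>)))))))"

primrec dist_pmf ::
  "nat \<Rightarrow> real \<Rightarrow> (nat \<Rightarrow> real) \<Rightarrow> nat \<Rightarrow> nat pmf \<Rightarrow> nat \<Rightarrow> qstate pmf" where
  "dist_pmf K lam \<mu> kstar \<pi> 0 = map_pmf (\<lambda>q. (q, q, \<lambda>_. 0, \<lambda>_. 0)) \<pi>"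
| "dist_pmf K lam \<mu> kstar \<pi> (Suc t) =
     bind_pmf (dist_pmf K lam \<mu> kstar \<pi> t) (step_pmf K lam \<mu> kstar (Suc t))"

lemma set_choice_pmf:
  assumes "K \<ge> 1"
  shows "set_pmf (choice_pmf K t S F) \<subseteq> {1..K}"
  using set_ts_pmf[OF assms, of S F] assms
  by (force simp: choice_pmf_def set_bind_pmf split: if_splits)

text \<open>\<open>PiM\<close> lives on functions that are \<open>undefined\<close> outside
  \<open>I\<close>, \<open>Pi_pmf\<close> on functions equal to \<open>d\<close> there; restriction
  translates. Equality holds because the coordinates of \<open>Pi_pmf\<close> are independent, which
  says precisely that their joint law is the product of the marginals.\<close>

lemma PiM_pmf_eq_distr:
  assumes "finite I" "I \<noteq> {}"
  shows "PiM I (\<lambda>k. measure_pmf (p k)) =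
     distr (measure_pmf (Pi_pmf I d p)) (PiM I (\<lambda>_. count_space UNIV)) (\<lambda>x. restrict x I)"
proof -
  let ?P = "measure_pmf (Pi_pmf I d p)"
  have "distr ?P (PiM I (\<lambda>_. count_space UNIV)) (\<lambda>x. \<lambda>i\<in>I. x i) = PiM I (\<lambda>i. distr ?P (count_space UNIV) (\<lambda>x. x i))"
    using indep_vars_Pi_pmf[OF assms(1), of d p]
    by (subst (asm) prob_space.indep_vars_iff_distr_eq_PiM'[OF measure_pmf.prob_space_axioms])
      (use assms in auto)
  moreover have "PiM I (\<lambda>i. distr ?P (count_space UNIV) (\<lambda>x. x i)) = PiM I (\<lambda>k. measure_pmf (p k))"
  proof (rule PiM_cong[OF refl])
    fix i assume "i \<in> I"
    then have "measure_pmf (map_pmf (\<lambda>f. f i) (Pi_pmf I d p)) = measure_pmf (p i)"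
      by (simp add: Pi_pmf_component assms)
    then show "distr ?P (count_space UNIV) (\<lambda>x. x i) = measure_pmf (p i)"
      by (simp add: map_pmf_rep_eq)
  qed
  ultimately show ?thesis by simp
qed

text \<open>The last assumption says that \<open>h\<close> reads only coordinates in
  \<open>I\<close>, so the two conventions outside \<open>I\<close> cannot be told apart.\<close>

lemma bind_PiM_bool_pmf:
  fixes h :: "(nat \<Rightarrow> bool) \<Rightarrow> 'b pmf"
  assumes "finite I" "I \<noteq> {}"
    and "\<And>R. h (restrict R I) = h R"
  shows "bind (PiM I (\<lambda>k. measure_pmf (p k))) (\<lambda>R. measure_pmf (h R))
      = measure_pmf (bind_pmf (Pi_pmf I d p) h)"
proof -
  have eq: "PiM I (\<lambda>_. count_space (UNIV :: bool set)) = count_space (PiE I (\<lambda>_. UNIV))"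
    using assms by (intro count_space_PiM_finite) auto
  have "bind (PiM I (\<lambda>k. measure_pmf (p k))) (\<lambda>R. measure_pmf (h R))
     = bind (measure_pmf (Pi_pmf I d p)) (\<lambda>x. measure_pmf (h (restrict x I)))"
    unfolding PiM_pmf_eq_distr[OF assms(1,2), where d = d]
  proof (rule bind_distr)
    show "(\<lambda>R. measure_pmf (h R)) \<in> PiM I (\<lambda>_. count_space UNIV) \<rightarrow>\<^sub>M subprob_algebra (count_space UNIV)"
      unfolding eq by (auto simp: space_subprob_algebra intro!: measure_pmf.subprob_space_axioms)
    show "(\<lambda>x. restrict x I) \<in> measure_pmf (Pi_pmf I d p) \<rightarrow>\<^sub>M PiM I (\<lambda>_. count_space UNIV)"
      unfolding eq by (auto simp: measurable_def)
  qed simp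
  also have "\<dots> = measure_pmf (bind_pmf (Pi_pmf I d p) h)"
    by (simp add: assms(3) measure_pmf_bind)
  finally show ?thesis .
qed

lemma qths_step_eq:
  assumes K: "K \<ge> 1" and ks: "ks \<in> {1..K}"
  shows "qths_step K lam \<mu> ks t s = measure_pmf (step_pmf K lam \<mu> ks t s)"
proof -
  obtain q qs S F where s: "s = (q, qs, S, F)" by (cases s)
  define g where "g A R \<kappa> = ((q + of_bool A) - of_bool (R \<kappa>),
          (qs + of_bool A) - of_bool (R ks),
          S(\<kappa> := S \<kappa> + of_bool (R \<kappa>)),
          F(\<kappa> := F \<kappa> + of_bool (\<not> R \<kappa>)))" for A and R :: "nat \<Rightarrow> bool" and \<kappa>
  let ?R = "Pi_pmf {1..K} False (\<lambda>k. bernoulli_pmf (\<mu> k))"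
  let ?C = "choice_pmf K t S F"
  have *: "bind (bern (explore_prob K t)) (\<lambda>E.
       bind (if E then measure_pmf (pmf_of_set {1..K}) else ts_choice K S F) (\<lambda>\<kappa>.
       return (count_space UNIV) (g A R \<kappa>))) = measure_pmf (bind_pmf ?C (\<lambda>\<kappa>. return_pmf (g A R \<kappa>)))"
    for A and R :: "nat \<Rightarrow> bool"
  proof -
    have "(if E then measure_pmf (pmf_of_set {1..K}) else ts_choice K S F)
       = measure_pmf (if E then pmf_of_set {1..K} else ts_pmf K S F)" for E
      by (simp add: measure_ts_pmf)
    then show ?thesis
      by (simp only: choice_pmf_def bind_assoc_pmf measure_pmf_bind return_pmf.rep_eq)
  qed
  \<comment> \<open>The new state reads \<open>R\<close> only at the chosen server and at
    \<open>ks\<close>, both in \<open>{1..K}\<close>.\<close>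
  have restr: "bind_pmf ?C (\<lambda>\<kappa>. return_pmf (g A (restrict R {1..K}) \<kappa>)) = bind_pmf ?C (\<lambda>\<kappa>. return_pmf (g A R \<kappa>))"
    for A R
    using set_choice_pmf[OF K, of t S F] ks by (intro bind_pmf_cong) (auto simp: g_def)
  have "qths_step K lam \<mu> ks t s = bind (bern lam) (\<lambda>A.
       bind (PiM {1..K} (\<lambda>k. bern (\<mu> k))) (\<lambda>R. measure_pmf (bind_pmf ?C (\<lambda>\<kappa>. return_pmf (g A R \<kappa>)))))"
    unfolding qths_step_def s by (simp only: prod.case g_def[symmetric] *)
  also have "\<dots> = bind (bern lam) (\<lambda>A. measure_pmf (bind_pmf ?R (\<lambda>R. bind_pmf ?C (\<lambda>\<kappa>. return_pmf (g A R \<kappa>)))))"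
    using K by (subst bind_PiM_bool_pmf[where d = False]) (auto simp: restr simp del: One_nat_def)
  also have "\<dots> = measure_pmf (bind_pmf (bernoulli_pmf lam) (\<lambda>A. bind_pmf ?R (\<lambda>R. bind_pmf ?C (\<lambda>\<kappa>. return_pmf (g A R \<kappa>)))))"
    by (simp add: measure_pmf_bind)
  also have "bind_pmf (bernoulli_pmf lam) (\<lambda>A. bind_pmf ?R (\<lambda>R. bind_pmf ?C (\<lambda>\<kappa>. return_pmf (g A R \<kappa>))))
    = bind_pmf (bernoulli_pmf lam) (\<lambda>A. bind_pmf ?C (\<lambda>\<kappa>. bind_pmf ?R (\<lambda>R. return_pmf (g A R \<kappa>))))"
    by (subst bind_commute_pmf[of ?R ?C]) simp
  also have "\<dots> = bind_pmf ?C (\<lambda>\<kappa>. bind_pmf (bernoulli_pmf lam) (\<lambda>A. bind_pmf ?R (\<lambda>R. return_pmf (g A R \<kappa>))))"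
    by (rule bind_commute_pmf)
  also have "\<dots> = step_pmf K lam \<mu> ks t s"
    by (simp only: step_pmf_def s prod.case g_def)
  finally show ?thesis .
qed

lemma qths_dist_eq:
  assumes K: "K \<ge> 1" and ks: "ks \<in> {1..K}"
  shows "qths_dist K lam \<mu> ks \<pi> t = measure_pmf (dist_pmf K lam \<mu> ks \<pi> t)"
proof (induction t)
  case 0
  show ?case by (simp add: map_pmf_rep_eq)
next
  case (Suc t)
  have "qths_step K lam \<mu> ks (Suc t) = (\<lambda>s. measure_pmf (step_pmf K lam \<mu> ks (Suc t) s))"
    by (rule ext) (rule qths_step_eq[OF K ks])
  then show ?case using Suc by (simp add: measure_pmf_bind)
qed

text \<open>A functional blind to the genie queue sees only the service of the chosen server, so the
  product over all servers collapses to a single Bernoulli variable.\<close>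

lemma nn_integral_step_pmf:
  assumes K: "K \<ge> 1"
  shows "(\<integral>\<^sup>+y. f (fst y) (fst (snd (snd y))) (snd (snd (snd y))) \<partial>step_pmf K lam \<mu> ks t (q, qs, S, F))
    = (\<integral>\<^sup>+\<kappa>. (\<integral>\<^sup>+A. (\<integral>\<^sup>+r. f ((q + of_bool A) - of_bool r) (S(\<kappa> := S \<kappa> + of_bool r))
          (F(\<kappa> := F \<kappa> + of_bool (\<not> r))) \<partial>bernoulli_pmf (\<mu> \<kappa>)) \<partial>bernoulli_pmf lam) \<partial>choice_pmf K t S F)"
proof -
  have "(\<integral>\<^sup>+R. f ((q + of_bool A) - of_bool (R \<kappa>)) (S(\<kappa> := S \<kappa> + of_bool (R \<kappa>)))
          (F(\<kappa> := F \<kappa> + of_bool (\<not> R \<kappa>))) \<partial>Pi_pmf {1..K} False (\<lambda>k. bernoulli_pmf (\<mu> k)))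
    = (\<integral>\<^sup>+r. f ((q + of_bool A) - of_bool r) (S(\<kappa> := S \<kappa> + of_bool r))
          (F(\<kappa> := F \<kappa> + of_bool (\<not> r))) \<partial>bernoulli_pmf (\<mu> \<kappa>))" (is "?L = ?R")
    if "\<kappa> \<in> {1..K}" for A \<kappa>
  proof -
    have "?R = (\<integral>\<^sup>+r. f ((q + of_bool A) - of_bool r) (S(\<kappa> := S \<kappa> + of_bool r))
          (F(\<kappa> := F \<kappa> + of_bool (\<not> r))) \<partial>map_pmf (\<lambda>R. R \<kappa>) (Pi_pmf {1..K} False (\<lambda>k. bernoulli_pmf (\<mu> k))))"
      using that by (subst Pi_pmf_component) auto
    then show ?thesis by simp
  qed
  then show ?thesis
    unfolding step_pmf_def prod.case nn_integral_bind_pmf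
    using set_choice_pmf[OF K, of t S F]
    by (intro nn_integral_cong_AE AE_pmfI nn_integral_cong)
      (auto simp: subset_iff simp del: One_nat_def)
qed

section \<open>One-step estimates\<close>

text \<open>Hoeffding's lemma with the mean put back. It is first obtained for a positive parameter;
  a negative one is reduced to it by exchanging success and failure.\<close>

lemma bernoulli_exp_le:
  fixes l p :: real
  assumes p: "0 \<le> p" "p \<le> 1"
  shows "p * exp l + (1 - p) \<le> exp (p * l + l\<^sup>2 / 8)"
proof -
  have pos: "r * exp h + (1 - r) \<le> exp (r * h + h\<^sup>2 / 8)"
    if r: "0 \<le> r" "r \<le> 1" and h: "h > 0" for r h :: real
  proof -
    interpret interval_bounded_random_variable "bern r" "\<lambda>b. of_bool b" 0 1
      by unfold_locales (auto simp: AE_measure_pmf_iff)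
    have "ennreal (exp (h * (1 - r)) * r + exp (- (h * r)) * (1 - r)) \<le> ennreal (exp (h\<^sup>2 / 8))"
      using Hoeffdings_lemma_nn_integral[OF h] r by (simp flip: ennreal_mult'' ennreal_plus)
    then have "exp (h * (1 - r)) * r + exp (- (h * r)) * (1 - r) \<le> exp (h\<^sup>2 / 8)"
      by (subst (asm) ennreal_le_iff) auto
    then have "(exp (h * (1 - r)) * r + exp (- (h * r)) * (1 - r)) * exp (r * h) \<le> exp (h\<^sup>2 / 8) * exp (r * h)"
      by (rule mult_right_mono) simp
    also have "(exp (h * (1 - r)) * r + exp (- (h * r)) * (1 - r)) * exp (r * h)
        = r * (exp (h * (1 - r)) * exp (r * h)) + (1 - r) * (exp (- (h * r)) * exp (r * h))"
      by (simp add: algebra_simps)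
    also have "\<dots> = r * exp h + (1 - r)"
      by (simp add: algebra_simps flip: exp_add)
    also have "exp (h\<^sup>2 / 8) * exp (r * h) = exp (r * h + h\<^sup>2 / 8)"
      by (simp add: add.commute flip: exp_add)
    finally show ?thesis .
  qed
  consider "l > 0" | "l = 0" | "l < 0" by linarith
  then show ?thesis
  proof cases
    case 3
    have "(1 - p) * exp (- l) + (1 - (1 - p)) \<le> exp ((1 - p) * (- l) + (- l)\<^sup>2 / 8)"
      using p 3 by (intro pos) auto
    then have "((1 - p) * exp (- l) + p) * exp l \<le> exp ((1 - p) * (- l) + l\<^sup>2 / 8) * exp l"
      by (intro mult_right_mono) auto
    also have "((1 - p) * exp (- l) + p) * exp l = p * exp l + (1 - p) * (exp (- l) * exp l)"
      by (simp add: algebra_simps)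
    also have "\<dots> = p * exp l + (1 - p)" by (simp flip: exp_add)
    also have "exp ((1 - p) * (- l) + l\<^sup>2 / 8) * exp l = exp (p * l + l\<^sup>2 / 8)"
      by (simp add: algebra_simps flip: exp_add)
    finally show ?thesis .
  qed (use pos p in auto)
qed

lemma nn_integral_pmf_if_single:
  fixes a b :: real
  assumes "0 \<le> a" "0 \<le> b"
  shows "(\<integral>\<^sup>+x. ennreal (if x = k then a else b) \<partial>measure_pmf p) = ennreal (b + (a - b) * pmf p k)"
proof -
  have "(\<integral>\<^sup>+x. ennreal (if x = k then a else b) \<partial>measure_pmf p)
     = ennreal (\<integral>x. (if x = k then a else b) \<partial>measure_pmf p)"
    using assms by (intro nn_integral_eq_integral measure_pmf.integrable_const_bound[where B = "max a b"]) auto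
  also have "(\<integral>x. (if x = k then a else b) \<partial>measure_pmf p) = (\<integral>x. b + (a - b) * indicator {k} x \<partial>measure_pmf p)"
    by (intro Bochner_Integration.integral_cong) auto
  also have "(\<integral>x. b + (a - b) * indicator {k} x \<partial>measure_pmf p) = b + (a - b) * pmf p k"
    by (subst Bochner_Integration.integral_add)
      (auto simp: measure_pmf_single intro!: measure_pmf.integrable_const_bound[where B = 1])
  finally show ?thesis .
qed

locale qths =
  fixes K :: nat and lam :: real and \<mu> :: "nat \<Rightarrow> real" and ks :: nat and \<pi> :: "nat pmf"
  assumes K: "K \<ge> 1" and lam0: "0 \<le> lam"
    and mu01: "k \<in> {1..K} \<Longrightarrow> 0 \<le> \<mu> k \<and> \<mu> k \<le> 1"
    and ks: "ks \<in> {1..K}"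
    and lam_less: "lam < \<mu> ks"
    and stationary: "genie_stationary lam (\<mu> ks) \<pi>"
begin

abbreviation "choice \<equiv> choice_pmf K"
abbreviation "step \<equiv> step_pmf K lam \<mu> ks"
abbreviation "state_pmf \<equiv> dist_pmf K lam \<mu> ks \<pi>"
abbreviation "eps \<equiv> \<mu> ks - lam"

text \<open>Conditional on the state \<open>x\<close> before slot \<open>t\<close>: the choice in
  slot \<open>t\<close> sees only counts up to \<open>t - 1\<close>. Hence it always occurs as
  \<open>wrong (Suc s)\<close> of a state at time \<open>s\<close>.\<close>

definition wrong :: "nat \<Rightarrow> qstate \<Rightarrow> real" where
  "wrong t x = measure_pmf.prob (choice t (fst (snd (snd x))) (snd (snd (snd x)))) (- {ks})"

definition pulls :: "nat \<Rightarrow> qstate \<Rightarrow> nat" where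
  "pulls k x = fst (snd (snd x)) k + snd (snd (snd x)) k"

definition wins :: "nat \<Rightarrow> qstate \<Rightarrow> nat" where
  "wins k x = fst (snd (snd x)) k"

lemma mu_ks: "0 < \<mu> ks" "\<mu> ks \<le> 1" and lam1: "lam \<le> 1" and eps: "0 < eps" "eps \<le> 1"
  using mu01[OF ks] lam0 lam_less by auto

lemma explore_prob01: "t \<ge> 1 \<Longrightarrow> 0 \<le> explore_prob K t \<and> explore_prob K t \<le> 1"
  by (auto simp: explore_prob_def)

lemma choice_ge:
  assumes "t \<ge> 1" "k \<in> {1..K}"
  shows "pmf (choice t S F) k \<ge> explore_prob K t / real K"
proof -
  have "pmf (choice t S F) k = explore_prob K t * pmf (pmf_of_set {1..K}) k
     + (1 - explore_prob K t) * pmf (ts_pmf K S F) k"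
    using explore_prob01[OF assms(1)] by (simp add: choice_pmf_def pmf_bind mult_ac)
  moreover have "pmf (pmf_of_set {1..K}) k = 1 / real K"
    using assms K by (simp add: pmf_of_set)
  moreover have "0 \<le> (1 - explore_prob K t) * pmf (ts_pmf K S F) k"
    using explore_prob01[OF assms(1)] by simp
  ultimately show ?thesis by simp
qed

lemma wrong_le:
  assumes "t \<ge> 1"
  shows "wrong t (q, qs, S, F) \<le> explore_prob K t + measure_pmf.prob (ts_pmf K S F) (- {ks})"
proof -
  have "wrong t (q, qs, S, F) = 1 - pmf (choice t S F) ks"
    unfolding wrong_def by (simp add: measure_pmf.prob_compl[of "{ks}", simplified] Compl_eq_Diff_UNIV measure_pmf_single)
  moreover have "measure_pmf.prob (ts_pmf K S F) (- {ks}) = 1 - pmf (ts_pmf K S F) ks"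
    by (simp add: measure_pmf.prob_compl[of "{ks}", simplified] Compl_eq_Diff_UNIV measure_pmf_single)
  moreover have "pmf (choice t S F) ks = explore_prob K t * pmf (pmf_of_set {1..K}) ks
     + (1 - explore_prob K t) * pmf (ts_pmf K S F) ks"
    using explore_prob01[OF assms(1)] by (simp add: choice_pmf_def pmf_bind mult_ac)
  moreover have "explore_prob K t * pmf (pmf_of_set {1..K}) ks \<ge> 0"
    using explore_prob01[OF assms(1)] by simp
  moreover have "explore_prob K t * pmf (ts_pmf K S F) ks \<le> explore_prob K t * 1"
    using explore_prob01[OF assms(1)] by (intro mult_left_mono pmf_le_1) auto
  ultimately show ?thesis by (simp add: algebra_simps)
qed

lemma wrong_nonneg: "0 \<le> wrong t x" and wrong_le_1: "wrong t x \<le> 1"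
  by (auto simp: wrong_def)

text \<open>One factor of a Chernoff bound for too few samples, at parameter 1. Whatever the
  history, exploration serves \<open>k\<close> with probability at least p =
  \<open>explore_prob K t / real K\<close>, so the moment shrinks by 1 - (1 - 1/e) p; the constant
  3/5 comes from 1/e \<le> 2/5.\<close>

lemma step_pulls:
  assumes t: "t \<ge> 1" and k: "k \<in> {1..K}"
  shows "(\<integral>\<^sup>+y. ennreal (exp (- real (pulls k y))) \<partial>step t x)
     \<le> ennreal (exp (- (3 / 5) * (explore_prob K t / real K))) * ennreal (exp (- real (pulls k x)))"
proof -
  obtain q qs S F where x: "x = (q, qs, S, F)" by (cases x)
  let ?T = "real (S k + F k)"
  have "(\<integral>\<^sup>+y. ennreal (exp (- real (pulls k y))) \<partial>step t x)
     = (\<integral>\<^sup>+\<kappa>. (\<integral>\<^sup>+A. (\<integral>\<^sup>+r. ennreal (exp (- real ((S(\<kappa> := S \<kappa> + of_bool r)) k + (F(\<kappa> := F \<kappa> + of_bool (\<not> r))) k)))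
         \<partial>bernoulli_pmf (\<mu> \<kappa>)) \<partial>bernoulli_pmf lam) \<partial>choice t S F)"
    unfolding pulls_def x by (rule nn_integral_step_pmf[OF K])
  also have "\<dots> = (\<integral>\<^sup>+\<kappa>. ennreal (if \<kappa> = k then exp (- ?T - 1) else exp (- ?T)) \<partial>choice t S F)"
  proof (rule nn_integral_cong)
    fix \<kappa>
    have "exp (- real ((S(\<kappa> := S \<kappa> + of_bool r)) k + (F(\<kappa> := F \<kappa> + of_bool (\<not> r))) k))
       = (if \<kappa> = k then exp (- ?T - 1) else exp (- ?T))" for r
      by (cases r) (auto simp: algebra_simps)
    then show "(\<integral>\<^sup>+A. (\<integral>\<^sup>+r. ennreal (exp (- real ((S(\<kappa> := S \<kappa> + of_bool r)) k + (F(\<kappa> := F \<kappa> + of_bool (\<not> r))) k)))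
         \<partial>bernoulli_pmf (\<mu> \<kappa>)) \<partial>bernoulli_pmf lam) = ennreal (if \<kappa> = k then exp (- ?T - 1) else exp (- ?T))"
      by simp
  qed
  also have "\<dots> = ennreal (exp (- ?T) + (exp (- ?T - 1) - exp (- ?T)) * pmf (choice t S F) k)"
    by (rule nn_integral_pmf_if_single) auto
  also have "\<dots> \<le> ennreal (exp (- (3 / 5) * (explore_prob K t / real K)) * exp (- ?T))"
  proof (rule ennreal_leI)
    let ?p = "explore_prob K t / real K"
    have p: "0 \<le> ?p" "?p \<le> pmf (choice t S F) k"
      using explore_prob01[OF t] choice_ge[OF t k] by auto
    have e: "exp (- 1 :: real) \<le> 2 / 5"
    proof -
      have "5 / 2 \<le> exp (1 :: real)"
        using exp_lower_Taylor_quadratic[of "1 :: real"] by simp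
      then show ?thesis by (simp add: exp_minus inverse_eq_divide divide_le_eq)
    qed
    have "exp (- ?T) + (exp (- ?T - 1) - exp (- ?T)) * pmf (choice t S F) k
        = exp (- ?T) * (1 - (1 - exp (- 1)) * pmf (choice t S F) k)"
      unfolding exp_diff exp_minus[of 1] by (simp add: algebra_simps divide_inverse)
    also have "\<dots> \<le> exp (- ?T) * (1 - (3 / 5) * ?p)"
    proof (rule mult_left_mono)
      have "(3 / 5) * ?p \<le> (1 - exp (- 1)) * pmf (choice t S F) k"
        using e p by (intro mult_mono) auto
      then show "1 - (1 - exp (- 1)) * pmf (choice t S F) k \<le> 1 - (3 / 5) * ?p" by simp
    qed simp
    also have "\<dots> \<le> exp (- ?T) * exp (- ((3 / 5) * ?p))"
      using exp_ge_add_one_self[of "- ((3 / 5) * ?p)"] by (intro mult_left_mono) auto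
    finally show "exp (- ?T) + (exp (- ?T - 1) - exp (- ?T)) * pmf (choice t S F) k
       \<le> exp (- (3 / 5) * ?p) * exp (- ?T)" by (simp add: mult.commute)
  qed
  finally show ?thesis by (simp add: x pulls_def ennreal_mult'')
qed

text \<open>The exponential supermartingale of the deviation. If \<open>k\<close> is served, the
  compensator l^2/8 is what Hoeffding's lemma costs; otherwise nothing changes. The adaptively
  chosen, random number of samples is thereby built in.\<close>

lemma step_mean:
  fixes l :: real
  assumes k: "k \<in> {1..K}"
  defines "M \<equiv> (\<lambda>y. ennreal (exp (l * (real (wins k y) - \<mu> k * real (pulls k y)) - l\<^sup>2 / 8 * real (pulls k y))))"
  shows "(\<integral>\<^sup>+y. M y \<partial>step t x) \<le> M x"
proof -
  obtain q qs S F where x: "x = (q, qs, S, F)" by (cases x)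
  define g where "g s f = l * (real s - \<mu> k * real (s + f)) - l\<^sup>2 / 8 * real (s + f)" for s f :: nat
  have "(\<integral>\<^sup>+y. M y \<partial>step t x)
     = (\<integral>\<^sup>+\<kappa>. (\<integral>\<^sup>+A. (\<integral>\<^sup>+r. ennreal (exp (g ((S(\<kappa> := S \<kappa> + of_bool r)) k) ((F(\<kappa> := F \<kappa> + of_bool (\<not> r))) k)))
         \<partial>bernoulli_pmf (\<mu> \<kappa>)) \<partial>bernoulli_pmf lam) \<partial>choice t S F)"
    unfolding M_def pulls_def wins_def x g_def by (rule nn_integral_step_pmf[OF K])
  also have "\<dots> \<le> (\<integral>\<^sup>+\<kappa>. M x \<partial>choice t S F)"
  proof (rule nn_integral_mono)
    fix \<kappa>
    have "(\<integral>\<^sup>+r. ennreal (exp (g ((S(\<kappa> := S \<kappa> + of_bool r)) k) ((F(\<kappa> := F \<kappa> + of_bool (\<not> r))) k)))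
         \<partial>bernoulli_pmf (\<mu> \<kappa>)) \<le> ennreal (exp (g (S k) (F k)))"
    proof (cases "\<kappa> = k")
      case True
      have m: "0 \<le> \<mu> k" "\<mu> k \<le> 1" using mu01[OF k] by auto
      have "(\<integral>\<^sup>+r. ennreal (exp (g ((S(\<kappa> := S \<kappa> + of_bool r)) k) ((F(\<kappa> := F \<kappa> + of_bool (\<not> r))) k)))
         \<partial>bernoulli_pmf (\<mu> \<kappa>)) = ennreal (exp (g (S k + 1) (F k)) * \<mu> k + exp (g (S k) (F k + 1)) * (1 - \<mu> k))"
        using True m by (simp flip: ennreal_mult'' ennreal_plus)
      also have "\<dots> \<le> ennreal (exp (g (S k) (F k)))"
      proof (rule ennreal_leI)
        have 1: "g (S k + 1) (F k) = g (S k) (F k) + (l - l * \<mu> k - l\<^sup>2 / 8)"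
          "g (S k) (F k + 1) = g (S k) (F k) + (- l * \<mu> k - l\<^sup>2 / 8)"
          by (simp_all add: g_def field_simps)
        have "exp (g (S k + 1) (F k)) * \<mu> k + exp (g (S k) (F k + 1)) * (1 - \<mu> k)
          = exp (g (S k) (F k)) * (exp (- (\<mu> k * l + l\<^sup>2 / 8)) * (\<mu> k * exp l + (1 - \<mu> k)))"
          unfolding 1 exp_add exp_diff exp_minus by (simp add: field_simps exp_minus)
        also have "\<dots> \<le> exp (g (S k) (F k)) * (exp (- (\<mu> k * l + l\<^sup>2 / 8)) * exp (\<mu> k * l + l\<^sup>2 / 8))"
          by (intro mult_left_mono bernoulli_exp_le m) auto
        also have "\<dots> = exp (g (S k) (F k))" by (simp flip: exp_add)
        finally show "exp (g (S k + 1) (F k)) * \<mu> k + exp (g (S k) (F k + 1)) * (1 - \<mu> k) \<le> exp (g (S k) (F k))" .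
      qed
      finally show ?thesis .
    qed simp
    then have "(\<integral>\<^sup>+A. (\<integral>\<^sup>+r. ennreal (exp (g ((S(\<kappa> := S \<kappa> + of_bool r)) k) ((F(\<kappa> := F \<kappa> + of_bool (\<not> r))) k)))
         \<partial>bernoulli_pmf (\<mu> \<kappa>)) \<partial>bernoulli_pmf lam) \<le> (\<integral>\<^sup>+A. ennreal (exp (g (S k) (F k))) \<partial>bernoulli_pmf lam)"
      by (intro nn_integral_mono)
    also have "\<dots> = M x"
      by (simp add: measure_pmf.emeasure_space_1 M_def x g_def wins_def pulls_def)
    finally show "(\<integral>\<^sup>+A. (\<integral>\<^sup>+r. ennreal (exp (g ((S(\<kappa> := S \<kappa> + of_bool r)) k) ((F(\<kappa> := F \<kappa> + of_bool (\<not> r))) k)))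
         \<partial>bernoulli_pmf (\<mu> \<kappa>)) \<partial>bernoulli_pmf lam) \<le> M x" .
  qed
  also have "\<dots> = M x" by (simp add: measure_pmf.emeasure_space_1)
  finally show ?thesis .
qed

end

section \<open>Drift of the exponential moment of the queue and of the excess over the genie
  queue\<close>

context qths begin

text \<open>\<open>arr\<close> and \<open>srv k\<close> are the moment generating functions of an
  arrival at \<open>eps\<close> and of a service of server \<open>k\<close> at \<open>- eps\<close>,
  that is, the mean factors by which they change exp(eps Q).\<close>

definition arr :: real where "arr = lam * exp eps + (1 - lam)"
definition srv :: "nat \<Rightarrow> real" where "srv k = \<mu> k * exp (- eps) + (1 - \<mu> k)"

lemma arr_pos: "0 < arr"
proof -
  have "1 * lam \<le> exp eps * lam" using eps lam0 by (intro mult_right_mono) auto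
  then show ?thesis by (simp add: arr_def algebra_simps)
qed

lemma srv_bounds:
  assumes "k \<in> {1..K}"
  shows "exp (- eps) \<le> srv k" "srv k \<le> 1" "0 < srv k"
proof -
  have m: "0 \<le> \<mu> k" "\<mu> k \<le> 1" using mu01[OF assms] by auto
  have e: "exp (- eps) \<le> 1" using eps by simp
  have "\<mu> k * exp (- eps) + (1 - \<mu> k) * exp (- eps) \<le> srv k"
    unfolding srv_def using mult_left_mono[OF e, of "1 - \<mu> k"] m by simp
  then show 1: "exp (- eps) \<le> srv k" by (simp add: algebra_simps)
  show "srv k \<le> 1"
    unfolding srv_def using mult_left_mono[OF e, of "\<mu> k"] m by simp
  show "0 < srv k" using 1 exp_gt_zero[of "- eps"] by linarith
qed

text \<open>The means contribute (lam - \<mu>) eps = - eps^2, and Hoeffding's lemma adds eps^2/8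
  twice.\<close>

lemma arr_srv_le: "arr * srv ks \<le> exp (- (3 / 4) * eps\<^sup>2)"
proof -
  have m: "0 \<le> \<mu> ks" "\<mu> ks \<le> 1" using mu01[OF ks] by auto
  have "arr * srv ks \<le> exp (lam * eps + eps\<^sup>2 / 8) * exp (\<mu> ks * (- eps) + (- eps)\<^sup>2 / 8)"
    unfolding arr_def srv_def
    using srv_bounds(3)[OF ks] unfolding srv_def
    by (intro mult_mono bernoulli_exp_le m lam0 lam1) auto
  also have "\<dots> = exp (- (3 / 4) * eps\<^sup>2)"
    by (simp add: power2_eq_square algebra_simps flip: exp_add) 
  finally show ?thesis .
qed

text \<open>For \<open>q > 0\<close> the truncated subtraction is an honest one, so the exponential
  factors into independent pieces. At \<open>q = 0\<close> this breaks down.\<close>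

lemma exp_queue_increment:
  assumes q: "q > 0" and k: "k \<in> {1..K}"
  shows "(\<integral>\<^sup>+A. (\<integral>\<^sup>+r. ennreal (exp (eps * real ((q + of_bool A) - of_bool r)))
      \<partial>bernoulli_pmf (\<mu> k)) \<partial>bernoulli_pmf lam) = ennreal (exp (eps * real q) * arr * srv k)"
proof -
  have m: "0 \<le> \<mu> k" "\<mu> k \<le> 1" using mu01[OF k] by auto
  have *: "exp (eps * real ((q + of_bool A) - of_bool r))
      = exp (eps * real q) * exp (eps * of_bool A) * exp (- eps * of_bool r)" for A r
  proof -
    have "real ((q + of_bool A) - of_bool r) = real q + of_bool A - of_bool r"
      using q by (cases r; cases A) auto
    then show ?thesis by (simp only: flip: exp_add) (simp add: algebra_simps)
  qed
  have "(\<integral>\<^sup>+A. (\<integral>\<^sup>+r. ennreal (exp (eps * real ((q + of_bool A) - of_bool r)))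
      \<partial>bernoulli_pmf (\<mu> k)) \<partial>bernoulli_pmf lam)
    = ennreal ((exp (eps * real q) * exp eps * exp (- eps) * \<mu> k + exp (eps * real q) * exp eps * (1 - \<mu> k)) * lam
       + (exp (eps * real q) * exp (- eps) * \<mu> k + exp (eps * real q) * (1 - \<mu> k)) * (1 - lam))"
    unfolding * using m lam0 lam1 by (simp flip: ennreal_mult'' ennreal_plus)
  also have "(exp (eps * real q) * exp eps * exp (- eps) * \<mu> k + exp (eps * real q) * exp eps * (1 - \<mu> k)) * lam
       + (exp (eps * real q) * exp (- eps) * \<mu> k + exp (eps * real q) * (1 - \<mu> k)) * (1 - lam)
     = exp (eps * real q) * arr * srv k"
    unfolding arr_def srv_def by algebra
  finally show ?thesis .
qed

lemma pmf_choice_ks: "pmf (choice t (fst (snd (snd x))) (snd (snd (snd x)))) ks = 1 - wrong t x"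
  unfolding wrong_def
  by (simp add: measure_pmf.prob_compl[of "{ks}", simplified] Compl_eq_Diff_UNIV measure_pmf_single)

text \<open>Other servers get no credit beyond \<open>srv k\<close> \<le> 1, so the mean service
  factor is at most s + p (1 - s) with s = \<open>srv ks\<close> and p = \<open>wrong t x\<close>.
  From s \<ge> exp(-eps) follows 1 - s \<le> (exp(eps) - 1) s \<le> 2 eps s, which turns the loss
  into the factor 1 + 2 eps p. The multiplicative form allows iteration.\<close>

lemma step_queue_pos:
  assumes q: "fst x > 0"
  shows "(\<integral>\<^sup>+y. ennreal (exp (eps * real (fst y))) \<partial>step t x)
     \<le> ennreal (exp (- (3 / 4) * eps\<^sup>2 + 2 * eps * wrong t x)) * ennreal (exp (eps * real (fst x)))"
proof -
  obtain q qs S F where x: "x = (q, qs, S, F)" by (cases x)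
  let ?E = "exp (eps * real q)"
  let ?w = "wrong t x"
  have "(\<integral>\<^sup>+y. ennreal (exp (eps * real (fst y))) \<partial>step t x)
     = (\<integral>\<^sup>+\<kappa>. (\<integral>\<^sup>+A. (\<integral>\<^sup>+r. ennreal (exp (eps * real ((q + of_bool A) - of_bool r)))
         \<partial>bernoulli_pmf (\<mu> \<kappa>)) \<partial>bernoulli_pmf lam) \<partial>choice t S F)"
    unfolding x by (rule nn_integral_step_pmf[OF K])
  also have "\<dots> \<le> (\<integral>\<^sup>+\<kappa>. ennreal (if \<kappa> = ks then ?E * arr * srv ks else ?E * arr) \<partial>choice t S F)"
  proof (rule nn_integral_mono_AE, rule AE_pmfI)
    fix \<kappa> assume "\<kappa> \<in> set_pmf (choice t S F)"
    then have k: "\<kappa> \<in> {1..K}" using set_choice_pmf[OF K] by blast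
    have "?E * arr * srv \<kappa> \<le> ?E * arr * 1"
      using srv_bounds[OF k] arr_pos by (intro mult_left_mono) auto
    then have "?E * arr * srv \<kappa> \<le> (if \<kappa> = ks then ?E * arr * srv ks else ?E * arr)" by simp
    then show "(\<integral>\<^sup>+A. (\<integral>\<^sup>+r. ennreal (exp (eps * real ((q + of_bool A) - of_bool r)))
         \<partial>bernoulli_pmf (\<mu> \<kappa>)) \<partial>bernoulli_pmf lam)
       \<le> ennreal (if \<kappa> = ks then ?E * arr * srv ks else ?E * arr)"
      using exp_queue_increment[OF _ k, of q] q x by (simp add: ennreal_leI)
  qed
  also have "\<dots> = ennreal (?E * arr + (?E * arr * srv ks - ?E * arr) * pmf (choice t S F) ks)"
    using srv_bounds[OF ks] arr_pos by (intro nn_integral_pmf_if_single) auto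
  also have "\<dots> \<le> ennreal (exp (- (3 / 4) * eps\<^sup>2 + 2 * eps * ?w) * ?E)"
  proof (rule ennreal_leI)
    have pm: "pmf (choice t S F) ks = 1 - ?w" using pmf_choice_ks[of t x] by (simp add: x)
    have w: "0 \<le> ?w" by (rule wrong_nonneg)
    have s: "0 < srv ks" "srv ks \<le> 1" "exp (- eps) \<le> srv ks" using srv_bounds[OF ks] by auto
    have "exp eps \<le> 1 + eps + eps\<^sup>2" using exp_bound[of eps] eps by simp
    also have "eps\<^sup>2 \<le> eps * 1" unfolding power2_eq_square using eps by (intro mult_left_mono) auto
    finally have e2: "exp eps - 1 \<le> 2 * eps" by simp
    have "1 \<le> exp eps * srv ks"
      using mult_left_mono[OF s(3), of "exp eps"] by (simp flip: exp_add)
    then have "1 - srv ks \<le> (exp eps - 1) * srv ks" by (simp add: algebra_simps)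
    also have "\<dots> \<le> (2 * eps) * srv ks" using e2 s by (intro mult_right_mono) auto
    finally have "?w * (1 - srv ks) \<le> ?w * (2 * eps * srv ks)" using w by (intro mult_left_mono) auto
    then have "srv ks + ?w * (1 - srv ks) \<le> srv ks * (1 + 2 * eps * ?w)" by (simp add: algebra_simps)
    also have "\<dots> \<le> srv ks * exp (2 * eps * ?w)" using s by (intro mult_left_mono) auto
    finally have "?E * arr * (srv ks + ?w * (1 - srv ks)) \<le> ?E * arr * (srv ks * exp (2 * eps * ?w))"
      using arr_pos by (intro mult_left_mono) auto
    also have "\<dots> = ?E * exp (2 * eps * ?w) * (arr * srv ks)" by (simp add: mult_ac)
    also have "\<dots> \<le> ?E * exp (2 * eps * ?w) * exp (- (3 / 4) * eps\<^sup>2)"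
      by (intro mult_left_mono arr_srv_le) auto
    also have "\<dots> = exp (- (3 / 4) * eps\<^sup>2 + 2 * eps * ?w) * ?E" by (simp only: exp_add mult_ac)
    also have "?E * arr * (srv ks + ?w * (1 - srv ks)) = ?E * arr + (?E * arr * srv ks - ?E * arr) * pmf (choice t S F) ks"
      unfolding pm by (simp add: algebra_simps)
    finally show "?E * arr + (?E * arr * srv ks - ?E * arr) * pmf (choice t S F) ks
       \<le> exp (- (3 / 4) * eps\<^sup>2 + 2 * eps * ?w) * ?E" .
  qed
  finally show ?thesis by (simp add: x ennreal_mult'')
qed

lemma set_step_pmf_le:
  assumes "y \<in> set_pmf (step t x)"
  shows "fst y \<le> fst x + 1" "fst y - fst (snd y) \<le> fst x - fst (snd x) + 1"
  using assms by (auto simp: step_pmf_def set_bind_pmf split: prod.splits)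

text \<open>An empty queue holds at most one job after the slot and \<open>eps\<close> is at most 1,
  so its moment is at most e; the additive term pays for this boundary case.\<close>

lemma step_queue:
  "(\<integral>\<^sup>+y. ennreal (exp (eps * real (fst y))) \<partial>step t x)
     \<le> ennreal (exp (- (3 / 4) * eps\<^sup>2 + 2 * eps * wrong t x)) * ennreal (exp (eps * real (fst x))) + ennreal (exp 1)"
proof (cases "fst x > 0")
  case True
  from step_queue_pos[OF this] show ?thesis by (rule order_trans) simp
next
  case False
  have "(\<integral>\<^sup>+y. ennreal (exp (eps * real (fst y))) \<partial>step t x) \<le> (\<integral>\<^sup>+y. ennreal (exp 1) \<partial>step t x)"
  proof (rule nn_integral_mono_AE, rule AE_pmfI, rule ennreal_leI)
    fix y assume "y \<in> set_pmf (step t x)"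
    then have "real (fst y) \<le> 1" using set_step_pmf_le(1)[of y t x] False by auto
    then have "eps * real (fst y) \<le> 1 * 1" using eps by (intro mult_mono) auto
    then show "exp (eps * real (fst y)) \<le> exp 1" by simp
  qed
  also have "\<dots> = ennreal (exp 1)" by (simp add: measure_pmf.emeasure_space_1)
  finally show ?thesis by (rule order_trans) simp
qed

text \<open>Natural subtraction makes this the positive part of Q - Q*. With the best server chosen
  both queues undergo the same map q -> (q + A - R)^+, which does not enlarge it; any other choice
  adds at most 1.\<close>

lemma step_regret:
  "(\<integral>\<^sup>+y. ennreal (real (fst y - fst (snd y))) \<partial>step t x)
     \<le> ennreal (real (fst x - fst (snd x))) + ennreal (wrong t x)"
proof -
  obtain q qs S F where x: "x = (q, qs, S, F)" by (cases x)
  let ?D = "real (q - qs)"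
  have "(\<integral>\<^sup>+y. ennreal (real (fst y - fst (snd y))) \<partial>step t x)
    \<le> (\<integral>\<^sup>+\<kappa>. ennreal (if \<kappa> = ks then ?D else ?D + 1) \<partial>choice t S F)"
    unfolding x step_pmf_def prod.case nn_integral_bind_pmf
  proof (rule nn_integral_mono)
    fix \<kappa>
    have "(\<integral>\<^sup>+A. (\<integral>\<^sup>+R. (\<integral>\<^sup>+y. ennreal (real (fst y - fst (snd y)))
          \<partial>return_pmf (q + of_bool A - of_bool (R \<kappa>), qs + of_bool A - of_bool (R ks),
               S(\<kappa> := S \<kappa> + of_bool (R \<kappa>)), F(\<kappa> := F \<kappa> + of_bool (\<not> R \<kappa>))))
         \<partial>Pi_pmf {1..K} False (\<lambda>k. bernoulli_pmf (\<mu> k))) \<partial>bernoulli_pmf lam)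
      \<le> (\<integral>\<^sup>+A. (\<integral>\<^sup>+R. ennreal (if \<kappa> = ks then ?D else ?D + 1) \<partial>Pi_pmf {1..K} False (\<lambda>k. bernoulli_pmf (\<mu> k))) \<partial>bernoulli_pmf lam)"
    proof (intro nn_integral_mono)
      fix A :: bool and R :: "nat \<Rightarrow> bool"
      have "real ((q + of_bool A - of_bool (R \<kappa>)) - (qs + of_bool A - of_bool (R ks))) \<le> (if \<kappa> = ks then ?D else ?D + 1)"
        by (cases A; cases "R \<kappa>"; cases "R ks") auto
      then show "(\<integral>\<^sup>+y. ennreal (real (fst y - fst (snd y)))
          \<partial>return_pmf (q + of_bool A - of_bool (R \<kappa>), qs + of_bool A - of_bool (R ks),
               S(\<kappa> := S \<kappa> + of_bool (R \<kappa>)), F(\<kappa> := F \<kappa> + of_bool (\<not> R \<kappa>))))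
        \<le> ennreal (if \<kappa> = ks then ?D else ?D + 1)"
        by (simp add: ennreal_leI)
    qed
    also have "\<dots> = ennreal (if \<kappa> = ks then ?D else ?D + 1)"
      by (simp add: measure_pmf.emeasure_space_1)
    finally show "(\<integral>\<^sup>+A. (\<integral>\<^sup>+R. (\<integral>\<^sup>+y. ennreal (real (fst y - fst (snd y)))
          \<partial>return_pmf (q + of_bool A - of_bool (R \<kappa>), qs + of_bool A - of_bool (R ks),
               S(\<kappa> := S \<kappa> + of_bool (R \<kappa>)), F(\<kappa> := F \<kappa> + of_bool (\<not> R \<kappa>))))
         \<partial>Pi_pmf {1..K} False (\<lambda>k. bernoulli_pmf (\<mu> k))) \<partial>bernoulli_pmf lam)
      \<le> ennreal (if \<kappa> = ks then ?D else ?D + 1)" .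
  qed
  also have "\<dots> = ennreal (?D + 1 + (?D - (?D + 1)) * pmf (choice t S F) ks)"
    by (rule nn_integral_pmf_if_single) auto
  also have "?D + 1 + (?D - (?D + 1)) * pmf (choice t S F) ks = ?D + wrong t x"
    using pmf_choice_ks[of t x] by (simp add: x)
  also have "ennreal (?D + wrong t x) = ennreal ?D + ennreal (wrong t x)"
    using wrong_nonneg by (intro ennreal_plus) auto
  finally show ?thesis by (simp add: x)
qed

lemma one_minus_exp_ge:
  fixes x :: real
  assumes "0 \<le> x" "x \<le> 1"
  shows "x / 2 \<le> 1 - exp (- x)"
proof -
  have "1 + x \<le> exp x" by simp
  then have "exp (- x) \<le> 1 / (1 + x)"
    using assms by (simp add: exp_minus inverse_eq_divide frac_le)
  also have "\<dots> \<le> 1 - x / 2"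
    using assms by (simp add: divide_simps) (simp add: algebra_simps mult_left_le)
  finally show ?thesis by simp
qed

text \<open>Integrating the drift inequality P f \<le> (1 - c) f + e against the stationary law
  cancels f and leaves c E f \<le> e. Since c \<ge> 3/8 eps^2 and e \<le> 3, the constant is 8. The
  cancellation needs a finite integral, so the queue is capped at \<open>N\<close> inside the
  exponential and \<open>N\<close> is sent to infinity by monotone convergence.\<close>

lemma stationary_exp_moment:
  "(\<integral>\<^sup>+q. ennreal (exp (eps * real q)) \<partial>measure_pmf \<pi>) \<le> ennreal (8 / eps\<^sup>2)"
proof -
  define c where "c = 1 - exp (- (3 / 4) * eps\<^sup>2)"
  have e1: "eps\<^sup>2 \<le> 1" "0 < eps\<^sup>2" using eps by (auto simp: power_le_one)
  then have c: "3 / 8 * eps\<^sup>2 \<le> c"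
    using one_minus_exp_ge[of "3 / 4 * eps\<^sup>2"] by (simp add: c_def)
  then have c0: "0 < c" using e1 by (intro less_le_trans[OF _ c]) simp
  have c1: "c \<le> 1" by (simp add: c_def)
  let ?Y = "\<lambda>N q. ennreal (exp (eps * real q)) * indicator {..<N} q"
  have bound: "(\<integral>\<^sup>+q. ?Y N q \<partial>measure_pmf \<pi>) \<le> ennreal (8 / eps\<^sup>2)" for N
  proof -
    define f where "f q = ennreal (exp (eps * real (min q N)))" for q
    have one: "(\<integral>\<^sup>+A. (\<integral>\<^sup>+r. f ((q + of_bool A) - of_bool r) \<partial>bernoulli_pmf (\<mu> ks)) \<partial>bernoulli_pmf lam)
        + ennreal c * ?Y N q \<le> f q + ennreal (exp 1)" (is "?P + _ \<le> _") for q
    proof -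
      \<comment> \<open>At or above the cap \<open>f\<close> is maximal and cannot grow; strictly
        between 0 and the cap the drift applies; at 0 the boundary bound e does.\<close>
      consider "q \<ge> N" | "q < N" "q > 0" | "q < N" "q = 0" by linarith
      then show ?thesis
      proof cases
        case 1
        have "?P \<le> (\<integral>\<^sup>+A. (\<integral>\<^sup>+r. f q \<partial>bernoulli_pmf (\<mu> ks)) \<partial>bernoulli_pmf lam)"
          using 1 eps by (intro nn_integral_mono) (auto simp: f_def intro!: ennreal_leI mult_left_mono)
        also have "\<dots> = f q" by (simp add: measure_pmf.emeasure_space_1)
        finally show ?thesis using 1 by (auto intro: order_trans)
      next
        case 2
        have "?P \<le> (\<integral>\<^sup>+A. (\<integral>\<^sup>+r. ennreal (exp (eps * real ((q + of_bool A) - of_bool r)))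
            \<partial>bernoulli_pmf (\<mu> ks)) \<partial>bernoulli_pmf lam)"
          using eps by (intro nn_integral_mono) (auto simp: f_def intro!: ennreal_leI mult_left_mono)
        also have "\<dots> = ennreal (exp (eps * real q) * (arr * srv ks))"
          using exp_queue_increment[OF 2(2) ks] by (simp add: mult_ac)
        also have "\<dots> \<le> ennreal (exp (eps * real q) * (1 - c))"
          using arr_srv_le by (intro ennreal_leI mult_left_mono) (auto simp: c_def)
        finally have "?P + ennreal c * ?Y N q \<le> ennreal (exp (eps * real q) * (1 - c)) + ennreal (c * exp (eps * real q))"
          using 2 c0 by (intro add_mono) (auto simp: ennreal_mult)
        also have "\<dots> = f q"
          using 2 c0 c1 by (subst ennreal_plus[symmetric]) (auto simp: f_def algebra_simps)
        finally show ?thesis by (rule order_trans) simp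
      next
        case 3
        have "?P \<le> (\<integral>\<^sup>+A. (\<integral>\<^sup>+r. ennreal (exp 1) \<partial>bernoulli_pmf (\<mu> ks)) \<partial>bernoulli_pmf lam)"
        proof (intro nn_integral_mono)
          fix A r :: bool
          have "real (min (q + of_bool A - of_bool r) N) \<le> 1" using 3 by (cases A; cases r) auto
          then have "eps * real (min (q + of_bool A - of_bool r) N) \<le> 1 * 1" using eps by (intro mult_mono) auto
          then show "f (q + of_bool A - of_bool r) \<le> ennreal (exp 1)" by (simp add: f_def ennreal_leI)
        qed
        also have "\<dots> = ennreal (exp 1)" by (simp add: measure_pmf.emeasure_space_1)
        finally have "?P + ennreal c * ?Y N q \<le> ennreal (exp 1) + f q"
          using 3 c1 by (intro add_mono) (auto simp: f_def intro: ennreal_leI)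
        then show ?thesis by (simp add: add.commute)
      qed
    qed
    let ?X = "\<integral>\<^sup>+q. f q \<partial>measure_pmf \<pi>"
    have "?X = (\<integral>\<^sup>+q. f q \<partial>measure_pmf (bind_pmf \<pi> (\<lambda>q. bind_pmf (bernoulli_pmf lam) (\<lambda>a.
        map_pmf (\<lambda>r. (q + of_bool a) - of_bool r) (bernoulli_pmf (\<mu> ks))))))"
      using stationary by (simp only: genie_stationary_def)
    then have X: "?X = (\<integral>\<^sup>+q. (\<integral>\<^sup>+A. (\<integral>\<^sup>+r. f ((q + of_bool A) - of_bool r)
        \<partial>bernoulli_pmf (\<mu> ks)) \<partial>bernoulli_pmf lam) \<partial>measure_pmf \<pi>)"
      by (simp only: nn_integral_bind_pmf nn_integral_map_pmf)
    have "?X \<le> (\<integral>\<^sup>+q. ennreal (exp (eps * real N)) \<partial>measure_pmf \<pi>)"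
      using eps by (intro nn_integral_mono) (auto simp: f_def intro!: ennreal_leI mult_left_mono)
    also have "\<dots> = ennreal (exp (eps * real N))" by (simp add: measure_pmf.emeasure_space_1)
    finally have fin: "?X \<noteq> \<infinity>" by (auto simp: top_unique)
    have "?X + ennreal c * (\<integral>\<^sup>+q. ?Y N q \<partial>measure_pmf \<pi>)
       = (\<integral>\<^sup>+q. (\<integral>\<^sup>+A. (\<integral>\<^sup>+r. f ((q + of_bool A) - of_bool r)
        \<partial>bernoulli_pmf (\<mu> ks)) \<partial>bernoulli_pmf lam) + ennreal c * ?Y N q \<partial>measure_pmf \<pi>)"
      by (subst nn_integral_add) (auto simp only: X nn_integral_cmult, auto simp: nn_integral_cmult)
    also have "\<dots> \<le> (\<integral>\<^sup>+q. f q + ennreal (exp 1) \<partial>measure_pmf \<pi>)"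
      by (intro nn_integral_mono one)
    also have "\<dots> = ?X + ennreal (exp 1)"
      by (subst nn_integral_add) (auto simp: measure_pmf.emeasure_space_1)
    finally have "ennreal c * (\<integral>\<^sup>+q. ?Y N q \<partial>measure_pmf \<pi>) \<le> ennreal (exp 1)"
      using fin by (simp add: ennreal_add_left_cancel_le)
    then have "ennreal (1 / c) * (ennreal c * (\<integral>\<^sup>+q. ?Y N q \<partial>measure_pmf \<pi>)) \<le> ennreal (1 / c) * ennreal (exp 1)"
      by (intro mult_left_mono) auto
    also have "ennreal (1 / c) * (ennreal c * (\<integral>\<^sup>+q. ?Y N q \<partial>measure_pmf \<pi>)) = (\<integral>\<^sup>+q. ?Y N q \<partial>measure_pmf \<pi>)"
      using c0 by (simp add: mult.assoc[symmetric] ennreal_mult[symmetric])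
    also have "ennreal (1 / c) * ennreal (exp 1) = ennreal (exp 1 / c)"
      using c0 by (simp add: ennreal_mult[symmetric])
    also have "\<dots> \<le> ennreal (8 / eps\<^sup>2)"
    proof (rule ennreal_leI)
      have "exp 1 / c \<le> 3 / (3 / 8 * eps\<^sup>2)"
        using c e1 exp_le by (intro frac_le) auto
      then show "exp 1 / c \<le> 8 / eps\<^sup>2" by simp
    qed
    finally show ?thesis .
  qed
  have "(\<integral>\<^sup>+q. ennreal (exp (eps * real q)) \<partial>measure_pmf \<pi>) = (\<integral>\<^sup>+q. (SUP N. ?Y N q) \<partial>measure_pmf \<pi>)"
  proof (rule nn_integral_cong)
    fix q
    have "?Y (Suc q) q \<le> (SUP N. ?Y N q)" by (rule SUP_upper) simp
    moreover have "(SUP N. ?Y N q) \<le> ennreal (exp (eps * real q))"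
      by (rule SUP_least) (auto simp: indicator_def)
    ultimately show "ennreal (exp (eps * real q)) = (SUP N. ?Y N q)" by (simp add: antisym)
  qed
  also have "\<dots> = (SUP N. \<integral>\<^sup>+q. ?Y N q \<partial>measure_pmf \<pi>)"
    by (rule nn_integral_monotone_convergence_SUP) (auto simp: incseq_def le_fun_def indicator_def)
  also have "\<dots> \<le> ennreal (8 / eps\<^sup>2)" by (rule SUP_least) (rule bound)
  finally show ?thesis .
qed

end

section \<open>Flagged paths\<close>

context qths begin

text \<open>The chain with two flags attached: the first records that \<open>ok\<close> has held at every time so far, the
  second that the queue has not been empty at any time from \<open>\<tau>\<close> on. Flagging the path keeps the
  exponential moment of the queue finite on the good paths, while on a bad path it could be as
  large as $e^{\epsilon t}$.\<close>

primrec aug :: "(nat \<Rightarrow> qstate \<Rightarrow> bool) \<Rightarrow> nat \<Rightarrow> nat \<Rightarrow> (qstate \<times> bool \<times> bool) pmf" where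
  "aug ok \<tau> 0 = map_pmf (\<lambda>x. (x, True, True)) (state_pmf 0)"
| "aug ok \<tau> (Suc s) = bind_pmf (aug ok \<tau> s) (\<lambda>z. map_pmf
     (\<lambda>y. (y, fst (snd z) \<and> ok (Suc s) y, snd (snd z) \<and> (\<tau> \<le> Suc s \<longrightarrow> fst y > 0)))
     (step (Suc s) (fst z)))"

lemma map_fst_aug: "map_pmf fst (aug ok \<tau> s) = state_pmf s"
proof (induction s)
  case (Suc s)
  have "map_pmf fst (aug ok \<tau> (Suc s)) = bind_pmf (aug ok \<tau> s) (\<lambda>z. step (Suc s) (fst z))"
    by (simp add: map_bind_pmf pmf.map_comp comp_def)
  also have "\<dots> = bind_pmf (map_pmf fst (aug ok \<tau> s)) (step (Suc s))"
    by (simp add: bind_map_pmf)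
  finally show ?case using Suc by simp
qed (simp add: pmf.map_comp comp_def)

lemma nn_integral_aug_fst: "(\<integral>\<^sup>+z. f (fst z) \<partial>aug ok \<tau> s) = (\<integral>\<^sup>+x. f x \<partial>state_pmf s)"
  unfolding map_fst_aug[of ok \<tau> s, symmetric] by simp

lemma nn_integral_aug_Suc:
  "(\<integral>\<^sup>+z. f z \<partial>aug ok \<tau> (Suc s)) = (\<integral>\<^sup>+z. (\<integral>\<^sup>+y. f (y, fst (snd z) \<and> ok (Suc s) y,
      snd (snd z) \<and> (\<tau> \<le> Suc s \<longrightarrow> fst y > 0)) \<partial>step (Suc s) (fst z)) \<partial>aug ok \<tau> s)"
  by simp

text \<open>Time 0 is excluded because both flags start as \<open>True\<close> without any
  check.\<close>

lemma aug_ok: "(x, True, c) \<in> set_pmf (aug ok \<tau> s) \<Longrightarrow> s \<ge> 1 \<Longrightarrow> ok s x"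
  by (cases s) (auto simp: set_bind_pmf)

lemma aug_busy: "(x, b, True) \<in> set_pmf (aug ok \<tau> s) \<Longrightarrow> s \<ge> 1 \<Longrightarrow> \<tau> \<le> s \<Longrightarrow> fst x > 0"
  by (cases s) (auto simp: set_bind_pmf)

lemma aug_before: "z \<in> set_pmf (aug ok \<tau> s) \<Longrightarrow> s < \<tau> \<Longrightarrow> snd (snd z)"
  by (induction s arbitrary: z) (auto simp: set_bind_pmf)

lemma state_regret_le: "x \<in> set_pmf (state_pmf s) \<Longrightarrow> fst x - fst (snd x) \<le> s"
proof (induction s arbitrary: x)
  case (Suc s)
  from Suc.prems obtain y where y: "y \<in> set_pmf (state_pmf s)" "x \<in> set_pmf (step (Suc s) y)"
    by (auto simp: set_bind_pmf)
  from Suc.IH[OF y(1)] set_step_pmf_le(2)[OF y(2)] show ?case by linarith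
qed auto

section \<open>Moments on good and on busy paths, and the excess after idling\<close>

definition good_moment :: "(nat \<Rightarrow> qstate \<Rightarrow> bool) \<Rightarrow> nat \<Rightarrow> nat \<Rightarrow> ennreal" where
  "good_moment ok \<tau> s = (\<integral>\<^sup>+z. (if fst (snd z) then ennreal (exp (eps * real (fst (fst z)))) else 0) \<partial>aug ok \<tau> s)"

definition busy_moment :: "(nat \<Rightarrow> qstate \<Rightarrow> bool) \<Rightarrow> nat \<Rightarrow> nat \<Rightarrow> ennreal" where
  "busy_moment ok \<tau> s = (\<integral>\<^sup>+z. (if fst (snd z) \<and> snd (snd z) then ennreal (exp (eps * real (fst (fst z)))) else 0) \<partial>aug ok \<tau> s)"

definition regret_after_idle :: "(nat \<Rightarrow> qstate \<Rightarrow> bool) \<Rightarrow> nat \<Rightarrow> nat \<Rightarrow> ennreal" where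
  "regret_after_idle ok \<tau> s = (\<integral>\<^sup>+z. (if snd (snd z) then 0 else ennreal (real (fst (fst z) - fst (snd (fst z))))) \<partial>aug ok \<tau> s)"

definition bad_prob :: "(nat \<Rightarrow> qstate \<Rightarrow> bool) \<Rightarrow> nat \<Rightarrow> nat \<Rightarrow> ennreal" where
  "bad_prob ok \<tau> s = (\<integral>\<^sup>+z. (if fst (snd z) then 0 else 1) \<partial>aug ok \<tau> s)"

lemma good_moment_Suc_crude: "good_moment ok \<tau> (Suc s) \<le> ennreal (exp eps) * good_moment ok \<tau> s"
proof -
  have "good_moment ok \<tau> (Suc s) \<le> (\<integral>\<^sup>+z. ennreal (exp eps) * (if fst (snd z) then ennreal (exp (eps * real (fst (fst z)))) else 0) \<partial>aug ok \<tau> s)"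
    unfolding good_moment_def nn_integral_aug_Suc fst_conv snd_conv
  proof (rule nn_integral_mono)
    fix z :: "qstate \<times> bool \<times> bool"
    have "(\<integral>\<^sup>+y. (if (fst (snd z) \<and> ok (Suc s) y)
         then ennreal (exp (eps * real (fst y))) else 0) \<partial>step (Suc s) (fst z))
      \<le> (\<integral>\<^sup>+y. (if fst (snd z) then ennreal (exp eps * exp (eps * real (fst (fst z)))) else 0) \<partial>step (Suc s) (fst z))"
    proof (rule nn_integral_mono_AE, rule AE_pmfI)
      fix y assume "y \<in> set_pmf (step (Suc s) (fst z))"
      then have "real (fst y) \<le> real (fst (fst z)) + 1" using set_step_pmf_le(1) by fastforce
      then have "eps * real (fst y) \<le> eps * (real (fst (fst z)) + 1)" using eps by (intro mult_left_mono) auto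
      then have "exp (eps * real (fst y)) \<le> exp eps * exp (eps * real (fst (fst z)))"
        by (simp add: algebra_simps flip: exp_add)
      then show "(if (fst (snd z) \<and> ok (Suc s) y)
         then ennreal (exp (eps * real (fst y))) else 0)
        \<le> (if fst (snd z) then ennreal (exp eps * exp (eps * real (fst (fst z)))) else 0)"
        by (auto intro: ennreal_leI)
    qed
    also have "\<dots> = ennreal (exp eps) * (if fst (snd z) then ennreal (exp (eps * real (fst (fst z)))) else 0)"
      by (simp add: measure_pmf.emeasure_space_1 ennreal_mult)
    finally show "(\<integral>\<^sup>+y. (if (fst (snd z) \<and> ok (Suc s) y)
         then ennreal (exp (eps * real (fst y))) else 0) \<partial>step (Suc s) (fst z))
      \<le> ennreal (exp eps) * (if fst (snd z) then ennreal (exp (eps * real (fst (fst z)))) else 0)" .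
  qed
  also have "\<dots> = ennreal (exp eps) * good_moment ok \<tau> s"
    unfolding good_moment_def by (rule nn_integral_cmult) simp
  finally show ?thesis .
qed

text \<open>While the servers are being learnt nothing is known about the choices, so each slot may
  cost a factor exp(eps), starting from the stationary moment. This is the price of the learning
  phase.\<close>

lemma good_moment_crude: "good_moment ok \<tau> s \<le> ennreal (exp (eps * real s) * (8 / eps\<^sup>2))"
proof (induction s)
  case 0
  show ?case using stationary_exp_moment by (simp add: good_moment_def)
next
  case (Suc s)
  have "good_moment ok \<tau> (Suc s) \<le> ennreal (exp eps) * ennreal (exp (eps * real s) * (8 / eps\<^sup>2))"
    by (rule order_trans[OF good_moment_Suc_crude]) (intro mult_left_mono Suc zero_le)
  also have "\<dots> = ennreal (exp eps * (exp (eps * real s) * (8 / eps\<^sup>2)))"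
    by (rule ennreal_mult[symmetric]) auto
  also have "exp eps * (exp (eps * real s) * (8 / eps\<^sup>2)) = (exp eps * exp (eps * real s)) * (8 / eps\<^sup>2)"
    by (simp only: mult.assoc)
  also have "exp eps * exp (eps * real s) = exp (eps * real (Suc s))"
    by (simp only: exp_add[symmetric]) (simp add: algebra_simps)
  finally show ?case .
qed

lemma good_moment_Suc:
  assumes s: "s \<ge> 1" and W: "\<And>x. ok s x \<Longrightarrow> wrong (Suc s) x \<le> w"
    and R: "good_moment ok \<tau> s \<le> ennreal R" "0 \<le> R"
  shows "good_moment ok \<tau> (Suc s) \<le> ennreal (exp (- (3 / 4) * eps\<^sup>2 + 2 * eps * w) * R + exp 1)"
proof -
  let ?r = "exp (- (3 / 4) * eps\<^sup>2 + 2 * eps * w)"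
  have "good_moment ok \<tau> (Suc s) \<le> (\<integral>\<^sup>+z. ennreal ?r * (if fst (snd z) then ennreal (exp (eps * real (fst (fst z)))) else 0)
      + ennreal (exp 1) \<partial>aug ok \<tau> s)"
    unfolding good_moment_def nn_integral_aug_Suc fst_conv snd_conv
  proof (rule nn_integral_mono_AE, rule AE_pmfI)
    fix z assume z: "z \<in> set_pmf (aug ok \<tau> s)"
    show "(\<integral>\<^sup>+y. (if (fst (snd z) \<and> ok (Suc s) y)
         then ennreal (exp (eps * real (fst y))) else 0) \<partial>step (Suc s) (fst z))
      \<le> ennreal ?r * (if fst (snd z) then ennreal (exp (eps * real (fst (fst z)))) else 0) + ennreal (exp 1)"
    proof (cases "fst (snd z)")
      case True
      then have "ok s (fst z)" using aug_ok[OF _ s, of "fst z" "snd (snd z)" ok \<tau>] z by (cases z) auto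
      then have "wrong (Suc s) (fst z) \<le> w" by (rule W)
      then have "eps * wrong (Suc s) (fst z) \<le> eps * w" using eps by (intro mult_left_mono) auto
      then have r: "exp (- (3 / 4) * eps\<^sup>2 + 2 * eps * wrong (Suc s) (fst z)) \<le> ?r"
        by (subst exp_le_cancel_iff) linarith
      have "(\<integral>\<^sup>+y. (if (fst (snd z) \<and> ok (Suc s) y)
         then ennreal (exp (eps * real (fst y))) else 0) \<partial>step (Suc s) (fst z))
         \<le> (\<integral>\<^sup>+y. ennreal (exp (eps * real (fst y))) \<partial>step (Suc s) (fst z))"
        by (intro nn_integral_mono) auto
      also have "\<dots> \<le> ennreal (exp (- (3 / 4) * eps\<^sup>2 + 2 * eps * wrong (Suc s) (fst z)))
          * ennreal (exp (eps * real (fst (fst z)))) + ennreal (exp 1)"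
        by (rule step_queue)
      also have "\<dots> \<le> ennreal ?r * ennreal (exp (eps * real (fst (fst z)))) + ennreal (exp 1)"
        by (intro add_right_mono mult_right_mono ennreal_leI r) auto
      finally show ?thesis using True by simp
    qed simp
  qed
  also have "\<dots> = ennreal ?r * good_moment ok \<tau> s + ennreal (exp 1)"
    unfolding good_moment_def by (subst nn_integral_add) (auto simp: nn_integral_cmult measure_pmf.emeasure_space_1)
  also have "\<dots> \<le> ennreal ?r * ennreal R + ennreal (exp 1)"
    by (intro add_right_mono mult_left_mono R) auto
  also have "\<dots> = ennreal (?r * R + exp 1)"
    using R(2) by (simp add: ennreal_mult ennreal_plus)
  finally show ?thesis .
qed

lemma busy_moment_le_Y: "busy_moment ok \<tau> s \<le> good_moment ok \<tau> s"
  unfolding busy_moment_def good_moment_def by (intro nn_integral_mono) auto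

text \<open>From \<open>\<tau>\<close> on the busy flag certifies a positive queue, so the boundary
  term of \<open>step_queue\<close> is absent and the moment decays geometrically, with no
  floor.\<close>

lemma busy_moment_Suc:
  assumes s: "s \<ge> 1" "\<tau> \<le> s" and W: "\<And>x. ok s x \<Longrightarrow> wrong (Suc s) x \<le> w"
    and R: "busy_moment ok \<tau> s \<le> ennreal R" "0 \<le> R"
  shows "busy_moment ok \<tau> (Suc s) \<le> ennreal (exp (- (3 / 4) * eps\<^sup>2 + 2 * eps * w) * R)"
proof -
  let ?r = "exp (- (3 / 4) * eps\<^sup>2 + 2 * eps * w)"
  have "busy_moment ok \<tau> (Suc s) \<le> (\<integral>\<^sup>+z. ennreal ?r * (if fst (snd z) \<and> snd (snd z) then ennreal (exp (eps * real (fst (fst z)))) else 0)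
      \<partial>aug ok \<tau> s)"
    unfolding busy_moment_def nn_integral_aug_Suc fst_conv snd_conv
  proof (rule nn_integral_mono_AE, rule AE_pmfI)
    fix z assume z: "z \<in> set_pmf (aug ok \<tau> s)"
    show "(\<integral>\<^sup>+y. (if (fst (snd z) \<and> ok (Suc s) y)
         \<and> (snd (snd z) \<and> (\<tau> \<le> Suc s \<longrightarrow> fst y > 0))
         then ennreal (exp (eps * real (fst y))) else 0) \<partial>step (Suc s) (fst z))
      \<le> ennreal ?r * (if fst (snd z) \<and> snd (snd z) then ennreal (exp (eps * real (fst (fst z)))) else 0)"
    proof (cases "fst (snd z) \<and> snd (snd z)")
      case True
      then have "ok s (fst z)" and q: "fst (fst z) > 0"
        using aug_ok[OF _ s(1), of "fst z" "snd (snd z)" ok \<tau>] aug_busy[OF _ s, of "fst z" "fst (snd z)" ok] z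
        by (cases z; auto)+
      then have "wrong (Suc s) (fst z) \<le> w" by (intro W)
      then have "eps * wrong (Suc s) (fst z) \<le> eps * w" using eps by (intro mult_left_mono) auto
      then have r: "exp (- (3 / 4) * eps\<^sup>2 + 2 * eps * wrong (Suc s) (fst z)) \<le> ?r"
        by (subst exp_le_cancel_iff) linarith
      have "(\<integral>\<^sup>+y. (if (fst (snd z) \<and> ok (Suc s) y)
         \<and> (snd (snd z) \<and> (\<tau> \<le> Suc s \<longrightarrow> fst y > 0))
         then ennreal (exp (eps * real (fst y))) else 0) \<partial>step (Suc s) (fst z))
         \<le> (\<integral>\<^sup>+y. ennreal (exp (eps * real (fst y))) \<partial>step (Suc s) (fst z))"
        by (intro nn_integral_mono) auto
      also have "\<dots> \<le> ennreal (exp (- (3 / 4) * eps\<^sup>2 + 2 * eps * wrong (Suc s) (fst z)))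
          * ennreal (exp (eps * real (fst (fst z))))"
        by (rule step_queue_pos[OF q])
      also have "\<dots> \<le> ennreal ?r * ennreal (exp (eps * real (fst (fst z))))"
        by (intro mult_right_mono ennreal_leI r) auto
      finally show ?thesis using True by simp
    qed auto
  qed
  also have "\<dots> = ennreal ?r * busy_moment ok \<tau> s"
    unfolding busy_moment_def by (rule nn_integral_cmult) simp
  also have "\<dots> \<le> ennreal ?r * ennreal R"
    by (intro mult_left_mono R) auto
  also have "\<dots> = ennreal (?r * R)"
    using R(2) by (simp add: ennreal_mult)
  finally show ?thesis .
qed

lemma bad_prob_le:
  assumes "\<And>s. 1 \<le> s \<Longrightarrow> s \<le> n \<Longrightarrow> (\<integral>\<^sup>+x. (if ok s x then 0 else 1) \<partial>state_pmf s) \<le> ennreal b" and b: "0 \<le> b"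
  shows "s \<le> n \<Longrightarrow> bad_prob ok \<tau> s \<le> ennreal (real s * b)"
proof (induction s)
  case 0
  show ?case by (simp add: bad_prob_def)
next
  case (Suc s)
  have "bad_prob ok \<tau> (Suc s) \<le> (\<integral>\<^sup>+z. (if fst (snd z) then 0 else 1)
      + (\<integral>\<^sup>+y. (if ok (Suc s) y then 0 else 1) \<partial>step (Suc s) (fst z)) \<partial>aug ok \<tau> s)"
    unfolding bad_prob_def nn_integral_aug_Suc fst_conv snd_conv
  proof (rule nn_integral_mono)
    fix z :: "qstate \<times> bool \<times> bool"
    show "(\<integral>\<^sup>+y. (if (fst (snd z) \<and> ok (Suc s) y) then 0 else 1) \<partial>step (Suc s) (fst z))
      \<le> (if fst (snd z) then 0 else 1) + (\<integral>\<^sup>+y. (if ok (Suc s) y then 0 else 1) \<partial>step (Suc s) (fst z))"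
      by (cases "fst (snd z)") (auto simp: measure_pmf.emeasure_space_1)
  qed
  also have "\<dots> = bad_prob ok \<tau> s + (\<integral>\<^sup>+z. (\<integral>\<^sup>+y. (if ok (Suc s) y then 0 else 1) \<partial>step (Suc s) (fst z)) \<partial>aug ok \<tau> s)"
    unfolding bad_prob_def by (rule nn_integral_add) auto
  also have "(\<integral>\<^sup>+z. (\<integral>\<^sup>+y. (if ok (Suc s) y then 0 else 1) \<partial>step (Suc s) (fst z)) \<partial>aug ok \<tau> s)
    = (\<integral>\<^sup>+x. (if ok (Suc s) x then 0 else 1) \<partial>state_pmf (Suc s))"
    using nn_integral_aug_fst[where f = "\<lambda>x. (\<integral>\<^sup>+y. (if ok (Suc s) y then 0 else 1) \<partial>step (Suc s) x)"] by simp
  also have "bad_prob ok \<tau> s + \<dots> \<le> ennreal (real s * b) + ennreal b"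
    by (rule add_mono[OF Suc.IH[OF Suc_leD[OF Suc.prems]] assms(1)]) (use Suc.prems in auto)
  also have "\<dots> = ennreal (real (Suc s) * b)"
    using b by (subst ennreal_plus[symmetric]) (auto simp: algebra_simps)
  finally show ?case .
qed

text \<open>A path enters this expectation only when its queue has just become empty, where the
  truncated difference is 0; entering is free. Later slots add the wrong-choice probability. Before
  \<open>\<tau>\<close> the flag cannot fall, so nothing is counted.\<close>

lemma regret_after_idle_Suc: "regret_after_idle ok \<tau> (Suc s) \<le> regret_after_idle ok \<tau> s + (if s < \<tau> then 0 else (\<integral>\<^sup>+x. ennreal (wrong (Suc s) x) \<partial>state_pmf s))"
proof -
  have "regret_after_idle ok \<tau> (Suc s) \<le> (\<integral>\<^sup>+z. (if snd (snd z) then 0 else ennreal (real (fst (fst z) - fst (snd (fst z)))))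
      + (if s < \<tau> then 0 else ennreal (wrong (Suc s) (fst z))) \<partial>aug ok \<tau> s)"
    unfolding regret_after_idle_def nn_integral_aug_Suc fst_conv snd_conv
  proof (rule nn_integral_mono_AE, rule AE_pmfI)
    fix z assume z: "z \<in> set_pmf (aug ok \<tau> s)"
    let ?lhs = "\<integral>\<^sup>+y. (if (snd (snd z) \<and> (\<tau> \<le> Suc s \<longrightarrow> fst y > 0)) then 0
         else ennreal (real (fst y
            - fst (snd y)))) \<partial>step (Suc s) (fst z)"
    show "?lhs \<le> (if snd (snd z) then 0 else ennreal (real (fst (fst z) - fst (snd (fst z)))))
      + (if s < \<tau> then 0 else ennreal (wrong (Suc s) (fst z)))"
    proof (cases "snd (snd z)")
      case True
      then have "?lhs \<le> (\<integral>\<^sup>+y. 0 \<partial>step (Suc s) (fst z))"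
        by (intro nn_integral_mono) auto
      then show ?thesis by simp
    next
      case False
      then have "s \<ge> \<tau>" using aug_before[OF z] by (meson leI)
      then show ?thesis using False step_regret[of "Suc s" "fst z"] by simp
    qed
  qed
  also have "\<dots> = regret_after_idle ok \<tau> s + (\<integral>\<^sup>+z. (if s < \<tau> then 0 else ennreal (wrong (Suc s) (fst z))) \<partial>aug ok \<tau> s)"
    unfolding regret_after_idle_def by (rule nn_integral_add) auto
  also have "(\<integral>\<^sup>+z. (if s < \<tau> then 0 else ennreal (wrong (Suc s) (fst z))) \<partial>aug ok \<tau> s)
     = (if s < \<tau> then 0 else (\<integral>\<^sup>+x. ennreal (wrong (Suc s) x) \<partial>state_pmf s))"
    using nn_integral_aug_fst[where f = "\<lambda>x. ennreal (wrong (Suc s) x)"] by simp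
  finally show ?thesis .
qed

text \<open>On bad paths and on good paths that never idled since \<open>\<tau>\<close> the excess
  is bounded by \<open>n\<close>. The probability of the latter is at most
  \<open>busy_moment\<close>, since exp(eps Q) \<ge> 1.\<close>

lemma nn_regret_le:
  "(\<integral>\<^sup>+x. ennreal (real (fst x - fst (snd x))) \<partial>state_pmf n)
     \<le> ennreal (real n) * (busy_moment ok \<tau> n + bad_prob ok \<tau> n) + regret_after_idle ok \<tau> n"
proof -
  have "(\<integral>\<^sup>+x. ennreal (real (fst x - fst (snd x))) \<partial>state_pmf n)
     = (\<integral>\<^sup>+z. ennreal (real (fst (fst z) - fst (snd (fst z)))) \<partial>aug ok \<tau> n)"
    by (rule nn_integral_aug_fst[symmetric])
  also have "\<dots> \<le> (\<integral>\<^sup>+z. (ennreal (real n) * ((if fst (snd z) \<and> snd (snd z) then ennreal (exp (eps * real (fst (fst z)))) else 0)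
      + (if fst (snd z) then 0 else 1))) + (if snd (snd z) then 0 else ennreal (real (fst (fst z) - fst (snd (fst z))))) \<partial>aug ok \<tau> n)"
  proof (rule nn_integral_mono_AE, rule AE_pmfI)
    fix z assume z: "z \<in> set_pmf (aug ok \<tau> n)"
    then have "fst z \<in> set_pmf (state_pmf n)" unfolding map_fst_aug[of ok \<tau> n, symmetric] by simp
    then have D: "fst (fst z) - fst (snd (fst z)) \<le> n" by (rule state_regret_le)
    have "ennreal (real n) * 1 \<le> ennreal (real n) * ennreal (exp (eps * real (fst (fst z))))"
      using eps by (intro mult_left_mono) auto
    then have E: "ennreal (real n) \<le> ennreal (real n) * ennreal (exp (eps * real (fst (fst z))))" by simp
    have D': "ennreal (real (fst (fst z) - fst (snd (fst z)))) \<le> ennreal (real n)" using D by (intro ennreal_leI) simp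
    from order_trans[OF D' E] D' show "ennreal (real (fst (fst z) - fst (snd (fst z)))) \<le>
      (ennreal (real n) * ((if fst (snd z) \<and> snd (snd z) then ennreal (exp (eps * real (fst (fst z)))) else 0)
      + (if fst (snd z) then 0 else 1))) + (if snd (snd z) then 0 else ennreal (real (fst (fst z) - fst (snd (fst z)))))"
      by (cases "snd (snd z)"; cases "fst (snd z)") auto
  qed
  also have "\<dots> = ennreal (real n) * (busy_moment ok \<tau> n + bad_prob ok \<tau> n) + regret_after_idle ok \<tau> n"
    unfolding busy_moment_def bad_prob_def regret_after_idle_def by (simp add: nn_integral_add nn_integral_cmult)
  finally show ?thesis .
qed

end

section \<open>Concentration and the regret recursion\<close>

context qths begin

lemma pulls_moment:
  assumes k: "k \<in> {1..K}"
  shows "(\<integral>\<^sup>+x. ennreal (exp (- real (pulls k x))) \<partial>state_pmf s)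
     \<le> ennreal (exp (- (3 / 5) * (\<Sum>i=1..s. explore_prob K i / real K)))"
proof (induction s)
  case 0
  show ?case by (simp add: pulls_def measure_pmf.emeasure_space_1)
next
  case (Suc s)
  let ?r = "exp (- (3 / 5) * (explore_prob K (Suc s) / real K))"
  have "(\<integral>\<^sup>+x. ennreal (exp (- real (pulls k x))) \<partial>state_pmf (Suc s))
    = (\<integral>\<^sup>+x. (\<integral>\<^sup>+y. ennreal (exp (- real (pulls k y))) \<partial>step (Suc s) x) \<partial>state_pmf s)"
    by simp
  also have "\<dots> \<le> (\<integral>\<^sup>+x. ennreal ?r * ennreal (exp (- real (pulls k x))) \<partial>state_pmf s)"
    by (intro nn_integral_mono step_pulls k) auto
  also have "\<dots> = ennreal ?r * (\<integral>\<^sup>+x. ennreal (exp (- real (pulls k x))) \<partial>state_pmf s)"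
    by (rule nn_integral_cmult) simp
  also have "\<dots> \<le> ennreal ?r * ennreal (exp (- (3 / 5) * (\<Sum>i=1..s. explore_prob K i / real K)))"
    by (intro mult_left_mono Suc) auto
  also have "\<dots> = ennreal (?r * exp (- (3 / 5) * (\<Sum>i=1..s. explore_prob K i / real K)))"
    by (rule ennreal_mult[symmetric]) auto
  also have "?r * exp (- (3 / 5) * (\<Sum>i=1..s. explore_prob K i / real K))
     = exp (- (3 / 5) * (\<Sum>i=1..Suc s. explore_prob K i / real K))"
    by (simp only: exp_add[symmetric]) (simp add: algebra_simps)
  finally show ?case .
qed

lemma mean_moment:
  fixes l :: real
  assumes k: "k \<in> {1..K}"
  shows "(\<integral>\<^sup>+x. ennreal (exp (l * (real (wins k x) - \<mu> k * real (pulls k x)) - l\<^sup>2 / 8 * real (pulls k x))) \<partial>state_pmf s) \<le> 1"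
proof (induction s)
  case 0
  show ?case by (simp add: pulls_def wins_def measure_pmf.emeasure_space_1)
next
  case (Suc s)
  let ?M = "\<lambda>x. ennreal (exp (l * (real (wins k x) - \<mu> k * real (pulls k x)) - l\<^sup>2 / 8 * real (pulls k x)))"
  have "(\<integral>\<^sup>+x. ?M x \<partial>state_pmf (Suc s)) = (\<integral>\<^sup>+x. (\<integral>\<^sup>+y. ?M y \<partial>step (Suc s) x) \<partial>state_pmf s)"
    by simp
  also have "\<dots> \<le> (\<integral>\<^sup>+x. ?M x \<partial>state_pmf s)"
    by (intro nn_integral_mono step_mean k)
  finally show ?case using Suc by simp
qed

text \<open>The accuracy condition is multiplied by the number of samples, so that no empirical mean
  of zero samples has to be formed.\<close>

definition good :: "real \<Rightarrow> real \<Rightarrow> qstate \<Rightarrow> bool" where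
  "good n0 d x \<longleftrightarrow> (\<forall>k\<in>{1..K}. n0 \<le> real (pulls k x) \<and>
     \<bar>real (wins k x) - \<mu> k * real (pulls k x)\<bar> \<le> d * real (pulls k x))"

text \<open>Markov's inequality in pointwise form: on a bad state one of three nonnegative variables
  reaches 1, namely exp(n0 - T_k) if samples are too few, or one of two scaled supermartingales if
  the mean is off to either side. Threshold and compensator are both linear in T_k, so no union over
  the values of T_k is required.\<close>

lemma not_good_le:
  assumes d: "0 < d" and n: "2 * n0 \<le> (\<Sum>i=1..s. explore_prob K i / real K)"
  shows "(\<integral>\<^sup>+x. (if good n0 d x then 0 else 1) \<partial>state_pmf s)
     \<le> ennreal (real K * (exp (- n0 / 5) + 2 * exp (- 2 * d\<^sup>2 * n0)))"
proof -
  define M where "M l k x = ennreal (exp (l * (real (wins k x) - \<mu> k * real (pulls k x)) - l\<^sup>2 / 8 * real (pulls k x)))"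
    for l k x
  let ?c = "ennreal (exp (- 2 * d\<^sup>2 * n0))"
  define f where "f k x = ennreal (exp n0) * ennreal (exp (- real (pulls k x))) + ?c * M (4 * d) k x + ?c * M (- 4 * d) k x"
    for k x
  \<comment> \<open>The parameter \<open>4 * d\<close> maximises l d - l^2/8, with maximum
    \<open>2 * d\<close> times \<open>d\<close>; the bound on the samples turns this rate into the
    constant \<open>?c\<close>.\<close>
  have mean: "1 \<le> ?c * M l k x"
    if T: "n0 \<le> real (pulls k x)" and l: "l\<^sup>2 = 16 * d\<^sup>2"
      and dev: "l * (real (wins k x) - \<mu> k * real (pulls k x)) \<ge> 4 * d\<^sup>2 * real (pulls k x)" for k x l
  proof -
    have "2 * d\<^sup>2 * n0 \<le> 2 * d\<^sup>2 * real (pulls k x)" using T by (intro mult_left_mono) auto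
    then have "0 \<le> - 2 * d\<^sup>2 * n0 + (l * (real (wins k x) - \<mu> k * real (pulls k x)) - l\<^sup>2 / 8 * real (pulls k x))"
      using dev unfolding l by simp
    then have "exp 0 \<le> exp (- 2 * d\<^sup>2 * n0 + (l * (real (wins k x) - \<mu> k * real (pulls k x)) - l\<^sup>2 / 8 * real (pulls k x)))"
      by (subst exp_le_cancel_iff)
    then have "1 \<le> exp (- 2 * d\<^sup>2 * n0) * exp (l * (real (wins k x) - \<mu> k * real (pulls k x)) - l\<^sup>2 / 8 * real (pulls k x))"
      by (simp only: exp_add exp_zero)
    then have "ennreal 1 \<le> ennreal (exp (- 2 * d\<^sup>2 * n0) * exp (l * (real (wins k x) - \<mu> k * real (pulls k x)) - l\<^sup>2 / 8 * real (pulls k x)))"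
      by (rule ennreal_leI)
    then show ?thesis unfolding M_def by (subst ennreal_mult[symmetric]) auto
  qed
  have pw: "(if good n0 d x then 0 else 1) \<le> (\<Sum>k\<in>{1..K}. f k x)" for x
  proof (cases "good n0 d x")
    case False
    then obtain k where k: "k \<in> {1..K}" and
      bad: "\<not> (n0 \<le> real (pulls k x) \<and> \<bar>real (wins k x) - \<mu> k * real (pulls k x)\<bar> \<le> d * real (pulls k x))"
      unfolding good_def by blast
    let ?D = "real (wins k x) - \<mu> k * real (pulls k x)"
    have "1 \<le> f k x"
    proof (cases "n0 \<le> real (pulls k x)")
      case False
      then have "exp 0 \<le> exp (n0 + - real (pulls k x))" by (subst exp_le_cancel_iff) simp
      then have "ennreal 1 \<le> ennreal (exp n0 * exp (- real (pulls k x)))"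
        by (intro ennreal_leI) (simp only: exp_add exp_zero)
      also have "\<dots> = ennreal (exp n0) * ennreal (exp (- real (pulls k x)))" by (rule ennreal_mult) auto
      also have "\<dots> \<le> f k x" unfolding f_def by (simp add: add.assoc)
      finally show ?thesis by simp
    next
      case True
      with bad have "?D \<ge> d * real (pulls k x) \<or> - ?D \<ge> d * real (pulls k x)" by linarith
      then show ?thesis
      proof
        assume "?D \<ge> d * real (pulls k x)"
        then have "4 * d * ?D \<ge> 4 * d * (d * real (pulls k x))" using d by (intro mult_left_mono) auto
        then have "1 \<le> ?c * M (4 * d) k x"
          using True by (intro mean) (auto simp: power2_eq_square algebra_simps)
        also have "\<dots> \<le> f k x" unfolding f_def by (simp add: add.commute add.left_commute)
        finally show ?thesis .
      next
        assume "- ?D \<ge> d * real (pulls k x)"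
        then have "4 * d * (- ?D) \<ge> 4 * d * (d * real (pulls k x))" using d by (intro mult_left_mono) auto
        then have "1 \<le> ?c * M (- 4 * d) k x"
          using True by (intro mean) (auto simp: power2_eq_square algebra_simps)
        also have "\<dots> \<le> f k x" unfolding f_def by (simp add: add.commute add.left_commute)
        finally show ?thesis .
      qed
    qed
    also have "f k x \<le> (\<Sum>k\<in>{1..K}. f k x)" using k by (intro member_le_sum) auto
    finally show ?thesis using False by simp
  qed simp
  have fk: "(\<integral>\<^sup>+x. f k x \<partial>state_pmf s) \<le> ennreal (exp (- n0 / 5) + 2 * exp (- 2 * d\<^sup>2 * n0))"
    if k: "k \<in> {1..K}" for k
  proof -
    have "(\<integral>\<^sup>+x. f k x \<partial>state_pmf s) = ennreal (exp n0) * (\<integral>\<^sup>+x. ennreal (exp (- real (pulls k x))) \<partial>state_pmf s)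
       + ?c * (\<integral>\<^sup>+x. M (4 * d) k x \<partial>state_pmf s) + ?c * (\<integral>\<^sup>+x. M (- 4 * d) k x \<partial>state_pmf s)"
      unfolding f_def by (simp add: nn_integral_add nn_integral_cmult)
    also have "\<dots> \<le> ennreal (exp n0) * ennreal (exp (- (3 / 5) * (\<Sum>i=1..s. explore_prob K i / real K))) + ?c * 1 + ?c * 1"
      unfolding M_def by (intro add_mono mult_left_mono mean_moment pulls_moment k zero_le)
    also have "\<dots> = ennreal (exp n0 * exp (- (3 / 5) * (\<Sum>i=1..s. explore_prob K i / real K)) + exp (- 2 * d\<^sup>2 * n0) + exp (- 2 * d\<^sup>2 * n0))"
      by (simp only: mult_1_right ennreal_plus ennreal_mult exp_ge_zero add_nonneg_nonneg mult_nonneg_nonneg)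
    also have "\<dots> \<le> ennreal (exp (- n0 / 5) + 2 * exp (- 2 * d\<^sup>2 * n0))"
    proof (rule ennreal_leI)
      \<comment> \<open>The exponent is at most n0 - (3/5)(2 n0) = - n0/5.\<close>
      have "exp n0 * exp (- (3 / 5) * (\<Sum>i=1..s. explore_prob K i / real K)) \<le> exp (- n0 / 5)"
        unfolding exp_add[symmetric] using n by (subst exp_le_cancel_iff) linarith
      then show "exp n0 * exp (- (3 / 5) * (\<Sum>i=1..s. explore_prob K i / real K)) + exp (- 2 * d\<^sup>2 * n0) + exp (- 2 * d\<^sup>2 * n0)
         \<le> exp (- n0 / 5) + 2 * exp (- 2 * d\<^sup>2 * n0)" by simp
    qed
    finally show ?thesis .
  qed
  have "(\<integral>\<^sup>+x. (if good n0 d x then 0 else 1) \<partial>state_pmf s) \<le> (\<integral>\<^sup>+x. (\<Sum>k\<in>{1..K}. f k x) \<partial>state_pmf s)"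
    by (intro nn_integral_mono pw)
  also have "\<dots> = (\<Sum>k\<in>{1..K}. \<integral>\<^sup>+x. f k x \<partial>state_pmf s)"
    by (rule nn_integral_sum) simp
  also have "\<dots> \<le> (\<Sum>k\<in>{1..K}. ennreal (exp (- n0 / 5) + 2 * exp (- 2 * d\<^sup>2 * n0)))"
    by (intro sum_mono fk)
  also have "\<dots> = ennreal (\<Sum>k\<in>{1..K}. (exp (- n0 / 5) + 2 * exp (- 2 * d\<^sup>2 * n0)))"
    by (intro sum_ennreal) (simp add: add_nonneg_nonneg)
  also have "(\<Sum>k\<in>{1..K}. (exp (- n0 / 5) + 2 * exp (- 2 * d\<^sup>2 * n0))) = real K * (exp (- n0 / 5) + 2 * exp (- 2 * d\<^sup>2 * n0))"
    by simp
  finally show ?thesis .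
qed

text \<open>A wrong exploitation has probability at most a sum of (T + 1) exp(-2 T d^2). Half of the
  exponent absorbs the polynomial factor through d^2 (T + 1) \<le> exp(T d^2); the other half is
  decreasing in T and is evaluated at \<open>n0\<close>.\<close>

lemma wrong_good_le:
  assumes t: "t \<ge> 1" and d: "0 < d" "d \<le> 1" and n0: "0 < n0"
    and gap: "\<And>k. k \<in> {1..K} \<Longrightarrow> k \<noteq> ks \<Longrightarrow> \<mu> k + 4 * d \<le> \<mu> ks"
    and x: "good n0 d x"
  shows "wrong t x \<le> explore_prob K t + 2 * real K * exp (- n0 * d\<^sup>2) / d\<^sup>2"
proof -
  obtain q qs S F where xx: "x = (q, qs, S, F)" by (cases x)
  have T: "n0 \<le> real (S k + F k)" "\<bar>real (S k) - \<mu> k * real (S k + F k)\<bar> \<le> d * real (S k + F k)"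
    if "k \<in> {1..K}" for k
    using x that unfolding good_def xx wins_def pulls_def by auto
  have d2: "0 < d\<^sup>2" "d\<^sup>2 \<le> 1" using d by (auto simp: power_le_one)
  have "emeasure (measure_pmf (ts_pmf K S F)) (- {ks})
     \<le> ennreal (\<Sum>k\<in>{1..K}. 2 * real (S k + F k + 1) * exp (- 2 * real (S k + F k) * d\<^sup>2))"
  proof (rule ts_pmf_wrong[OF K ks d(1), where \<mu> = \<mu>])
    fix k assume k: "k \<in> {1..K}"
    have "0 < real (S k + F k)" using T(1)[OF k] n0 by linarith
    then show "0 < S k + F k" by (simp only: of_nat_0_less_iff)
    show "\<bar>real (S k) - \<mu> k * real (S k + F k)\<bar> \<le> d * real (S k + F k)" by (rule T(2)[OF k])
  qed (rule gap)
  then have "measure_pmf.prob (ts_pmf K S F) (- {ks}) \<le> (\<Sum>k\<in>{1..K}. 2 * real (S k + F k + 1) * exp (- 2 * real (S k + F k) * d\<^sup>2))"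
    unfolding measure_pmf.emeasure_eq_measure by (subst (asm) ennreal_le_iff) (auto intro!: sum_nonneg)
  also have "\<dots> \<le> (\<Sum>k\<in>{1..K}. 2 * (exp (- n0 * d\<^sup>2) / d\<^sup>2))"
  proof (rule sum_mono)
    fix k assume k: "k \<in> {1..K}"
    let ?T = "real (S k + F k)"
    have "d\<^sup>2 * (?T + 1) \<le> 1 + ?T * d\<^sup>2" using d2 by (simp add: algebra_simps)
    also have "\<dots> \<le> exp (?T * d\<^sup>2)" by simp
    finally have "?T + 1 \<le> exp (?T * d\<^sup>2) / d\<^sup>2" using d2 by (simp add: le_divide_eq mult.commute)
    then have "(?T + 1) * exp (- 2 * ?T * d\<^sup>2) \<le> exp (?T * d\<^sup>2) / d\<^sup>2 * exp (- 2 * ?T * d\<^sup>2)"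
      by (rule mult_right_mono) simp
    also have "\<dots> = (exp (?T * d\<^sup>2) * exp (- 2 * ?T * d\<^sup>2)) / d\<^sup>2" by simp
    also have "\<dots> = exp (- ?T * d\<^sup>2) / d\<^sup>2" unfolding exp_add[symmetric] by (simp add: algebra_simps)
    also have "\<dots> \<le> exp (- n0 * d\<^sup>2) / d\<^sup>2"
    proof (rule divide_right_mono)
      have "n0 * d\<^sup>2 \<le> ?T * d\<^sup>2" using d2 by (intro mult_right_mono T(1)[OF k]) auto
      then show "exp (- ?T * d\<^sup>2) \<le> exp (- n0 * d\<^sup>2)"
        by (simp only: exp_le_cancel_iff mult_minus_left neg_le_iff_le)
    qed (use d2 in simp)
    finally have "2 * ((?T + 1) * exp (- 2 * ?T * d\<^sup>2)) \<le> 2 * (exp (- n0 * d\<^sup>2) / d\<^sup>2)"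
      by (rule mult_left_mono) simp
    then show "2 * real (S k + F k + 1) * exp (- 2 * ?T * d\<^sup>2) \<le> 2 * (exp (- n0 * d\<^sup>2) / d\<^sup>2)"
      by (simp only: of_nat_add of_nat_1 mult.assoc)
  qed
  also have "\<dots> = 2 * real K * exp (- n0 * d\<^sup>2) / d\<^sup>2" by simp
  finally show ?thesis using wrong_le[OF t, of q qs S F] xx by simp
qed

text \<open>Four phases. Up to \<open>g\<close> there is no control and the moment grows by exp(eps)
  per slot. Up to \<open>h\<close> the means are accurate but exploration may be frequent, costing
  exp(2 eps P). Up to \<open>\<tau>\<close> the moment contracts to order \<open>n\<close>. In the
  final window the busy moment decays, and the wrong choices made there are the only source of
  excess on paths that have idled.\<close>

lemma regret_bound:
  fixes d n0 P :: real and g h \<tau> n :: nat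
  defines "\<eta> \<equiv> 2 * real K * exp (- n0 * d\<^sup>2) / d\<^sup>2"
    and "\<beta> \<equiv> real K * (exp (- n0 / 5) + 2 * exp (- 2 * d\<^sup>2 * n0))"
  assumes d: "0 < d" "d \<le> 1" and n0: "0 < n0"
    and gap: "\<And>k. k \<in> {1..K} \<Longrightarrow> k \<noteq> ks \<Longrightarrow> \<mu> k + 4 * d \<le> \<mu> ks"
    and g: "1 \<le> g" and ord: "g \<le> h" "h \<le> \<tau>" "\<tau> \<le> n"
    and pulls: "2 * n0 \<le> (\<Sum>i=1..g. explore_prob K i / real K)"
    and P: "(\<Sum>i\<in>{g<..h}. explore_prob K i + \<eta>) \<le> P"
    and small: "\<And>s. h < s \<Longrightarrow> s \<le> n \<Longrightarrow> explore_prob K s + \<eta> \<le> eps / 8"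
  shows "(\<integral>\<^sup>+x. ennreal (real (fst x - fst (snd x))) \<partial>state_pmf n) \<le> ennreal
     (real n * (exp (- (eps\<^sup>2 / 2) * real (n - \<tau>)) * (exp (- (eps\<^sup>2 / 2) * real (\<tau> - h)) *
        (exp (2 * eps * P) * (exp (eps * real g) * (8 / eps\<^sup>2) + 3 * real n)) + 3 * real n) + real n * \<beta>)
      + (\<Sum>s\<in>{\<tau><..n}. explore_prob K s + \<eta> + \<beta>))"
proof -
  \<comment> \<open>Vacuous before \<open>g\<close>, when too few samples can be guaranteed; so no
    failure is charged to those times.\<close>
  define ok where "ok = (\<lambda>s x. g \<le> s \<longrightarrow> good n0 d x)"
  define W where "W s = explore_prob K s + \<eta>" for s
  have \<eta>0: "0 \<le> \<eta>" and \<beta>0: "0 \<le> \<beta>" using d by (auto simp: \<eta>_def \<beta>_def)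
  have W0: "0 \<le> W s" if "s \<ge> 1" for s using explore_prob01[OF that] \<eta>0 by (simp add: W_def)
  have W: "wrong (Suc s) x \<le> W (Suc s)" if "g \<le> s" "ok s x" for s x
    using that wrong_good_le[OF _ d n0 gap, of "Suc s" x] by (simp add: ok_def W_def \<eta>_def)
  have bad: "(\<integral>\<^sup>+x. (if ok s x then 0 else 1) \<partial>state_pmf s) \<le> ennreal \<beta>" for s
  proof (cases "g \<le> s")
    case True
    have "(\<Sum>i=1..g. explore_prob K i / real K) \<le> (\<Sum>i=1..s. explore_prob K i / real K)"
      using True explore_prob01 by (intro sum_mono2) auto
    with pulls have "2 * n0 \<le> (\<Sum>i=1..s. explore_prob K i / real K)" by linarith
    from not_good_le[OF d(1) this] show ?thesis using True by (simp add: ok_def \<beta>_def)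
  qed (simp add: ok_def)
  have e3: "exp (1::real) \<le> 3" by (rule exp_le)
  define A where "A = exp (eps * real g) * (8 / eps\<^sup>2)"
  have A0: "0 \<le> A" by (simp add: A_def)
  \<comment> \<open>The negative drift is given up here and only the cost of wrong choices is kept.
    Each slot adds e \<le> 3, which may be placed inside the growing factor because that factor is
    at least 1.\<close>
  have S0: "good_moment ok \<tau> (g + j) \<le> ennreal (exp (2 * eps * (\<Sum>i\<in>{g<..g + j}. W i)) * (A + 3 * real j))" for j
  proof (induction j)
    case 0
    show ?case using good_moment_crude[of ok \<tau> g] by (simp add: A_def)
  next
    case (Suc j)
    let ?S = "\<Sum>i\<in>{g<..g + j}. W i"
    have S': "(\<Sum>i\<in>{g<..g + Suc j}. W i) = W (Suc (g + j)) + ?S"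
    proof -
      have "{g<..g + Suc j} = insert (Suc (g + j)) {g<..g + j}" by auto
      then show ?thesis by simp
    qed
    have S0: "0 \<le> ?S" using g by (intro sum_nonneg W0) auto
    have "good_moment ok \<tau> (Suc (g + j)) \<le> ennreal (exp (- (3 / 4) * eps\<^sup>2 + 2 * eps * W (Suc (g + j)))
         * (exp (2 * eps * ?S) * (A + 3 * real j)) + exp 1)"
      using g A0 by (intro good_moment_Suc Suc W) auto
    also have "\<dots> \<le> ennreal (exp (2 * eps * (\<Sum>i\<in>{g<..g + Suc j}. W i)) * (A + 3 * real (Suc j)))"
    proof (rule ennreal_leI)
      have "exp (- (3 / 4) * eps\<^sup>2 + 2 * eps * W (Suc (g + j))) * (exp (2 * eps * ?S) * (A + 3 * real j))
        \<le> exp (2 * eps * W (Suc (g + j))) * (exp (2 * eps * ?S) * (A + 3 * real j))"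
        using A0 by (intro mult_right_mono) auto
      also have "\<dots> = (exp (2 * eps * W (Suc (g + j))) * exp (2 * eps * ?S)) * (A + 3 * real j)"
        by (simp only: mult.assoc)
      also have "exp (2 * eps * W (Suc (g + j))) * exp (2 * eps * ?S) = exp (2 * eps * (\<Sum>i\<in>{g<..g + Suc j}. W i))"
        unfolding S' exp_add[symmetric] by (simp only: distrib_left)
      finally have 1: "exp (- (3 / 4) * eps\<^sup>2 + 2 * eps * W (Suc (g + j))) * (exp (2 * eps * ?S) * (A + 3 * real j))
         \<le> exp (2 * eps * (\<Sum>i\<in>{g<..g + Suc j}. W i)) * (A + 3 * real j)" .
      have "0 \<le> 2 * eps * (\<Sum>i\<in>{g<..g + Suc j}. W i)"
        unfolding S' using S0 W0 eps by (intro mult_nonneg_nonneg) auto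
      then have "1 * 3 \<le> exp (2 * eps * (\<Sum>i\<in>{g<..g + Suc j}. W i)) * 3"
        by (intro mult_right_mono) auto
      moreover have "exp (2 * eps * (\<Sum>i\<in>{g<..g + Suc j}. W i)) * (A + 3 * real (Suc j))
          = exp (2 * eps * (\<Sum>i\<in>{g<..g + Suc j}. W i)) * (A + 3 * real j)
            + exp (2 * eps * (\<Sum>i\<in>{g<..g + Suc j}. W i)) * 3"
        unfolding distrib_left[symmetric] by (simp add: add.assoc)
      ultimately show "exp (- (3 / 4) * eps\<^sup>2 + 2 * eps * W (Suc (g + j)))
         * (exp (2 * eps * ?S) * (A + 3 * real j)) + exp 1
         \<le> exp (2 * eps * (\<Sum>i\<in>{g<..g + Suc j}. W i)) * (A + 3 * real (Suc j))"
        using 1 e3 by linarith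
    qed
    finally show ?case by simp
  qed
  define Yh where "Yh = exp (2 * eps * P) * (A + 3 * real n)"
  have Yh0: "0 \<le> Yh" using A0 by (simp add: Yh_def)
  have Yh: "good_moment ok \<tau> h \<le> ennreal Yh"
  proof -
    have "2 * eps * (\<Sum>i\<in>{g<..h}. W i) \<le> 2 * eps * P"
      using P eps unfolding W_def by (intro mult_left_mono) auto
    moreover have "good_moment ok \<tau> h \<le> ennreal (exp (2 * eps * (\<Sum>i\<in>{g<..h}. W i)) * (A + 3 * real (h - g)))"
      using S0[of "h - g"] ord by simp
    moreover have "exp (2 * eps * (\<Sum>i\<in>{g<..h}. W i)) * (A + 3 * real (h - g)) \<le> Yh"
      unfolding Yh_def using calculation(1) A0 ord by (intro mult_mono) auto
    ultimately show ?thesis by (meson ennreal_leI order_trans)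
  qed
  \<comment> \<open>Wrong choices now cost at most 2 eps (eps/8) = eps^2/4 in the exponent, leaving
    -3/4 + 1/4 = -1/2.\<close>
  have rho: "exp (- (3 / 4) * eps\<^sup>2 + 2 * eps * W s) \<le> exp (- (eps\<^sup>2 / 2))" if "h < s" "s \<le> n" for s
  proof -
    have "eps * W s \<le> eps * (eps / 8)" using small[OF that] eps unfolding W_def by (intro mult_left_mono) auto
    moreover have "eps * (eps / 8) = eps\<^sup>2 / 8" by (simp add: power2_eq_square)
    ultimately show ?thesis by (subst exp_le_cancel_iff) linarith
  qed
  have expS: "exp (- (eps\<^sup>2 / 2)) * exp (- (eps\<^sup>2 / 2) * real j) = exp (- (eps\<^sup>2 / 2) * real (Suc j))" for j
    unfolding exp_add[symmetric] by (simp only: of_nat_Suc distrib_left mult_1_right)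
  have S1: "h + j \<le> n \<Longrightarrow> good_moment ok \<tau> (h + j) \<le> ennreal (exp (- (eps\<^sup>2 / 2) * real j) * Yh + 3 * real j)" for j
  proof (induction j)
    case 0
    show ?case using Yh by simp
  next
    case (Suc j)
    let ?R = "exp (- (eps\<^sup>2 / 2) * real j) * Yh + 3 * real j"
    have "good_moment ok \<tau> (Suc (h + j)) \<le> ennreal (exp (- (3 / 4) * eps\<^sup>2 + 2 * eps * W (Suc (h + j))) * ?R + exp 1)"
      using g ord Yh0 Suc by (intro good_moment_Suc W Suc.IH) auto
    also have "\<dots> \<le> ennreal (exp (- (eps\<^sup>2 / 2) * real (Suc j)) * Yh + 3 * real (Suc j))"
    proof (rule ennreal_leI)
      have "exp (- (3 / 4) * eps\<^sup>2 + 2 * eps * W (Suc (h + j))) * ?R \<le> exp (- (eps\<^sup>2 / 2)) * ?R"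
        using Yh0 Suc.prems by (intro mult_right_mono rho) auto
      also have "\<dots> = (exp (- (eps\<^sup>2 / 2)) * exp (- (eps\<^sup>2 / 2) * real j)) * Yh + exp (- (eps\<^sup>2 / 2)) * (3 * real j)"
        by (simp only: distrib_left mult.assoc)
      also have "\<dots> \<le> exp (- (eps\<^sup>2 / 2) * real (Suc j)) * Yh + 1 * (3 * real j)"
        unfolding expS by (intro add_left_mono mult_right_mono) auto
      finally show "exp (- (3 / 4) * eps\<^sup>2 + 2 * eps * W (Suc (h + j))) * ?R + exp 1
         \<le> exp (- (eps\<^sup>2 / 2) * real (Suc j)) * Yh + 3 * real (Suc j)"
        using e3 by simp
    qed
    finally show ?case by simp
  qed
  define Yt where "Yt = exp (- (eps\<^sup>2 / 2) * real (\<tau> - h)) * Yh + 3 * real n"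
  have Yt0: "0 \<le> Yt" using Yh0 by (simp add: Yt_def)
  \<comment> \<open>So far an idle queue may have refilled, which is why an additive
    \<open>3 * real n\<close> remains; restricting to busy paths removes this term from now
    on.\<close>
  have Yt: "busy_moment ok \<tau> \<tau> \<le> ennreal Yt"
  proof -
    have "good_moment ok \<tau> \<tau> \<le> ennreal (exp (- (eps\<^sup>2 / 2) * real (\<tau> - h)) * Yh + 3 * real (\<tau> - h))"
      using S1[of "\<tau> - h"] ord by simp
    also have "\<dots> \<le> ennreal Yt" unfolding Yt_def using ord by (intro ennreal_leI add_left_mono) auto
    finally show ?thesis using busy_moment_le_Y order_trans by blast
  qed
  have S2: "\<tau> + j \<le> n \<Longrightarrow> busy_moment ok \<tau> (\<tau> + j) \<le> ennreal (exp (- (eps\<^sup>2 / 2) * real j) * Yt)" for j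
  proof (induction j)
    case 0
    show ?case using Yt by simp
  next
    case (Suc j)
    let ?R = "exp (- (eps\<^sup>2 / 2) * real j) * Yt"
    have "busy_moment ok \<tau> (Suc (\<tau> + j)) \<le> ennreal (exp (- (3 / 4) * eps\<^sup>2 + 2 * eps * W (Suc (\<tau> + j))) * ?R)"
      using g ord Yt0 Suc by (intro busy_moment_Suc W Suc.IH) auto
    also have "\<dots> \<le> ennreal (exp (- (eps\<^sup>2 / 2)) * ?R)"
      using Yt0 Suc.prems ord by (intro ennreal_leI mult_right_mono rho) auto
    also have "exp (- (eps\<^sup>2 / 2)) * ?R = exp (- (eps\<^sup>2 / 2) * real (Suc j)) * Yt"
      by (simp only: mult.assoc[symmetric] expS)
    finally show ?case by simp
  qed
  have Zn: "busy_moment ok \<tau> n \<le> ennreal (exp (- (eps\<^sup>2 / 2) * real (n - \<tau>)) * Yt)"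
    using S2[of "n - \<tau>"] ord by simp
  have Bn: "bad_prob ok \<tau> n \<le> ennreal (real n * \<beta>)"
    by (rule bad_prob_le[of n]) (use bad \<beta>0 in auto)
  \<comment> \<open>On inaccurate states the trivial bound 1 is used; their probability contributes
    \<open>\<beta>\<close>.\<close>
  have Ew: "(\<integral>\<^sup>+x. ennreal (wrong (Suc s) x) \<partial>state_pmf s) \<le> ennreal (W (Suc s) + \<beta>)" if "g \<le> s" for s
  proof -
    have "(\<integral>\<^sup>+x. ennreal (wrong (Suc s) x) \<partial>state_pmf s) \<le> (\<integral>\<^sup>+x. ennreal (W (Suc s)) + (if ok s x then 0 else 1) \<partial>state_pmf s)"
    proof (rule nn_integral_mono)
      fix x
      show "ennreal (wrong (Suc s) x) \<le> ennreal (W (Suc s)) + (if ok s x then 0 else 1)"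
      proof (cases "ok s x")
        case True
        then show ?thesis using W[OF that True] by (simp add: ennreal_leI)
      next
        case False
        have "ennreal (wrong (Suc s) x) \<le> 1" using wrong_le_1 by (simp add: ennreal_le_1)
        then show ?thesis using False by (simp add: add_increasing)
      qed
    qed
    also have "\<dots> = ennreal (W (Suc s)) + (\<integral>\<^sup>+x. (if ok s x then 0 else 1) \<partial>state_pmf s)"
      by (subst nn_integral_add) (auto simp: measure_pmf.emeasure_space_1)
    also have "\<dots> \<le> ennreal (W (Suc s)) + ennreal \<beta>"
      by (intro add_left_mono bad)
    finally show ?thesis using W0[of "Suc s"] \<beta>0 by (simp add: ennreal_plus)
  qed
  have V0: "s \<le> \<tau> \<Longrightarrow> regret_after_idle ok \<tau> s = 0" for s
  proof (induction s)
    case 0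
    show ?case by (simp add: regret_after_idle_def)
  next
    case (Suc s)
    then show ?case using regret_after_idle_Suc[of ok \<tau> s] by simp
  qed
  have V1: "regret_after_idle ok \<tau> (\<tau> + j) \<le> ennreal (\<Sum>s\<in>{\<tau><..\<tau> + j}. W s + \<beta>)" for j
  proof (induction j)
    case 0
    show ?case using V0[of \<tau>] by simp
  next
    case (Suc j)
    have S': "(\<Sum>s\<in>{\<tau><..\<tau> + Suc j}. W s + \<beta>) = (\<Sum>s\<in>{\<tau><..\<tau> + j}. W s + \<beta>) + (W (Suc (\<tau> + j)) + \<beta>)"
    proof -
      have "{\<tau><..\<tau> + Suc j} = insert (Suc (\<tau> + j)) {\<tau><..\<tau> + j}" by auto
      then show ?thesis by simp
    qed
    have "regret_after_idle ok \<tau> (Suc (\<tau> + j)) \<le> regret_after_idle ok \<tau> (\<tau> + j) + (\<integral>\<^sup>+x. ennreal (wrong (Suc (\<tau> + j)) x) \<partial>state_pmf (\<tau> + j))"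
      using regret_after_idle_Suc[of ok \<tau> "\<tau> + j"] by simp
    also have "\<dots> \<le> ennreal (\<Sum>s\<in>{\<tau><..\<tau> + j}. W s + \<beta>) + ennreal (W (Suc (\<tau> + j)) + \<beta>)"
      using ord by (intro add_mono Suc Ew) auto
    also have "\<dots> = ennreal (\<Sum>s\<in>{\<tau><..\<tau> + Suc j}. W s + \<beta>)"
      unfolding S' using W0 \<beta>0 by (intro ennreal_plus[symmetric] sum_nonneg add_nonneg_nonneg) auto
    finally show ?case by simp
  qed
  have Vn: "regret_after_idle ok \<tau> n \<le> ennreal (\<Sum>s\<in>{\<tau><..n}. W s + \<beta>)" using V1[of "n - \<tau>"] ord by simp
  have sum0: "0 \<le> (\<Sum>s\<in>{\<tau><..n}. W s + \<beta>)" using W0 \<beta>0 by (intro sum_nonneg add_nonneg_nonneg) auto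
  have "(\<integral>\<^sup>+x. ennreal (real (fst x - fst (snd x))) \<partial>state_pmf n)
     \<le> ennreal (real n) * (busy_moment ok \<tau> n + bad_prob ok \<tau> n) + regret_after_idle ok \<tau> n"
    by (rule nn_regret_le)
  also have "\<dots> \<le> ennreal (real n) * (ennreal (exp (- (eps\<^sup>2 / 2) * real (n - \<tau>)) * Yt) + ennreal (real n * \<beta>))
      + ennreal (\<Sum>s\<in>{\<tau><..n}. W s + \<beta>)"
    by (intro add_mono mult_left_mono Zn Bn Vn zero_le)
  also have "\<dots> = ennreal (real n * (exp (- (eps\<^sup>2 / 2) * real (n - \<tau>)) * Yt + real n * \<beta>) + (\<Sum>s\<in>{\<tau><..n}. W s + \<beta>))"
    using Yt0 \<beta>0 sum0 by (simp add: ennreal_mult ennreal_plus)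
  finally show ?thesis unfolding Yt_def Yh_def A_def W_def .
qed

end

section \<open>Choice of the time scales\<close>

lemma ln_diff_le_sum_inverse:
  assumes "m \<ge> 1"
  shows "ln (real (m + j)) - ln (real m) \<le> (\<Sum>i=m..<m + j. 1 / real i)"
proof (induction j)
  case (Suc j)
  have "ln (real (m + Suc j)) - ln (real (m + j)) = ln (real (m + Suc j) / real (m + j))"
    using assms by (subst ln_div) auto
  also have "\<dots> \<le> real (m + Suc j) / real (m + j) - 1"
    using assms by (intro ln_le_minus_one) auto
  also have "\<dots> = 1 / real (m + j)" using assms by (simp add: field_simps)
  finally show ?case using Suc by simp
qed simp

lemma sum_inverse_le_ln:
  assumes "n \<ge> 1"
  shows "(\<Sum>i=1..n. 1 / real i) \<le> 1 + ln (real n)"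
  using assms
proof (induction n rule: nat_induct_at_least)
  case (Suc n)
  have "ln (real n) - ln (real (Suc n)) = ln (real n / real (Suc n))"
    using Suc.hyps by (subst ln_div) auto
  also have "\<dots> \<le> real n / real (Suc n) - 1"
    using Suc.hyps by (intro ln_le_minus_one) auto
  also have "\<dots> = - (1 / real (Suc n))" by (simp add: field_simps)
  finally show ?case using Suc.IH by simp
qed simp

lemma ln_squared_le:
  fixes x :: real
  assumes "x \<ge> 1"
  shows "(ln x)\<^sup>2 \<le> x"
proof -
  have "ln (sqrt x / exp 1) \<le> sqrt x / exp 1 - 1"
    using assms by (intro ln_le_minus_one) auto
  moreover have "ln (sqrt x / exp 1) = ln (sqrt x) - 1"
    using assms by (subst ln_div) auto
  moreover have "ln (sqrt x) = ln x / 2" using assms by (simp add: ln_sqrt)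
  ultimately have "ln x \<le> 2 * (sqrt x / exp 1)" by linarith
  also have "sqrt x / exp 1 \<le> sqrt x / 2"
    using assms exp_ge_add_one_self[of "1::real"] by (intro divide_left_mono) auto
  finally have "ln x \<le> sqrt x" by simp
  then have "(ln x)\<^sup>2 \<le> (sqrt x)\<^sup>2" using assms by (intro power_mono) auto
  then show ?thesis using assms by simp
qed

text \<open>Only slots from K a to K a^2 are counted. There both terms of the minimum dominate (ln
  a)^2 / i: the cap 1/K because i \<ge> K a \<ge> K (ln a)^2, the other because i \<ge> a. The
  harmonic sum over this range is at least ln a.\<close>

lemma explore_sum_ge:
  assumes K: "K \<ge> 1" and a: "a \<ge> 1"
  shows "(ln (real a)) ^ 3 \<le> (\<Sum>i=1..K * a\<^sup>2. explore_prob K i / real K)"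
proof -
  have Ka: "K * a \<ge> 1" "K * a \<le> K * a\<^sup>2" using K a by (auto simp: power2_eq_square)
  have la: "0 \<le> ln (real a)" using a by simp
  have summand: "(ln (real a))\<^sup>2 * (1 / real i) \<le> explore_prob K i / real K" if i: "i \<ge> K * a" for i
  proof -
    have i1: "i \<ge> 1" "i \<ge> a" using i Ka(1) K le_trans[of a "K * a" i] le_trans[of 1 "K * a" i] by auto
    have iK: "real K * real a \<le> real i" using i by (simp flip: of_nat_mult)
    have "(ln (real a))\<^sup>2 * (1 / real i) \<le> 1 / real K"
    proof -
      have "(ln (real a))\<^sup>2 * real K \<le> real a * real K"
        using ln_squared_le[of "real a"] a by (intro mult_right_mono) auto
      also have "\<dots> \<le> real i" using iK by (simp add: mult.commute)
      finally show ?thesis using i1 K by (simp add: field_simps)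
    qed
    moreover have "(ln (real a))\<^sup>2 * (1 / real i) \<le> 3 * (ln (real i))\<^sup>2 / real i"
    proof -
      have "ln (real a) \<le> ln (real i)" using i1 a by simp
      then have "(ln (real a))\<^sup>2 \<le> (ln (real i))\<^sup>2" using la by (intro power_mono) auto
      then have "(ln (real a))\<^sup>2 \<le> 3 * (ln (real i))\<^sup>2" using zero_le_power2[of "ln (real i)"] by linarith
      then show ?thesis using i1 by (simp add: divide_right_mono)
    qed
    moreover have "explore_prob K i / real K = min (1 / real K) (3 * (ln (real i))\<^sup>2 / real i)"
      unfolding explore_prob_def using K by (simp add: min_divide_distrib_right)
    ultimately show ?thesis by simp
  qed
  have "(ln (real a)) ^ 3 = (ln (real a))\<^sup>2 * ln (real a)" by (simp add: power3_eq_cube power2_eq_square)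
  also have "\<dots> \<le> (ln (real a))\<^sup>2 * (\<Sum>i=K * a..<K * a + (K * a\<^sup>2 - K * a + 1). 1 / real i)"
  proof (rule mult_left_mono)
    have "ln (real a) = ln (real (K * a\<^sup>2)) - ln (real (K * a))"
      using K a by (simp add: ln_mult power2_eq_square)
    also have "\<dots> \<le> ln (real (K * a + (K * a\<^sup>2 - K * a + 1))) - ln (real (K * a))"
      using Ka by (intro diff_right_mono, subst ln_le_cancel_iff) (simp_all add: add_pos_nonneg)
    also have "\<dots> \<le> (\<Sum>i=K * a..<K * a + (K * a\<^sup>2 - K * a + 1). 1 / real i)"
      by (rule ln_diff_le_sum_inverse[OF Ka(1)])
    finally show "ln (real a) \<le> (\<Sum>i=K * a..<K * a + (K * a\<^sup>2 - K * a + 1). 1 / real i)" .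
  qed simp
  also have "\<dots> = (\<Sum>i=K * a..<K * a + (K * a\<^sup>2 - K * a + 1). (ln (real a))\<^sup>2 * (1 / real i))"
    by (rule sum_distrib_left)
  also have "\<dots> \<le> (\<Sum>i=K * a..<K * a + (K * a\<^sup>2 - K * a + 1). explore_prob K i / real K)"
    by (intro sum_mono summand) auto
  also have "\<dots> \<le> (\<Sum>i=1..K * a\<^sup>2. explore_prob K i / real K)"
    using Ka by (intro sum_mono2) (auto simp: explore_prob_def simp del: One_nat_def intro: le_trans)
  finally show ?thesis .
qed

lemma explore_prob_le:
  assumes "1 \<le> s" "s \<le> n"
  shows "explore_prob K s \<le> 3 * real K * (ln (real n))\<^sup>2 * (1 / real s)"
proof -
  have "explore_prob K s \<le> 3 * real K * (ln (real s))\<^sup>2 / real s"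
    by (simp add: explore_prob_def)
  also have "\<dots> \<le> 3 * real K * (ln (real n))\<^sup>2 / real s"
    using assms by (intro divide_right_mono mult_left_mono power_mono) auto
  finally show ?thesis by simp
qed

text \<open>\<open>regret_bound\<close> with explicit time scales. The lower bounds on
  \<open>L\<close> and \<open>w\<close> are the only largeness conditions; they hold beyond a
  universal threshold.\<close>

lemma (in qths) regret_le:
  fixes n :: nat and \<Delta> L w v v' :: real
  defines "L \<equiv> ln (real n)" and "w \<equiv> w_fun \<Delta> (real n)"
    and "v \<equiv> v_fun K eps \<Delta> (real n)" and "v' \<equiv> v'_fun K eps \<Delta> (real n)"
  assumes gap: "\<And>k. k \<in> {1..K} \<Longrightarrow> k \<noteq> ks \<Longrightarrow> \<mu> k + \<Delta> \<le> \<mu> ks"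
    and \<Delta>: "0 < \<Delta>" "\<Delta> \<le> 1"
    and L: "L \<ge> 20000" and wL: "w \<ge> 10000 * L ^ 3" and n6: "real n \<ge> exp (6 / \<Delta>\<^sup>2)"
    and vv: "v + v' \<le> real n / 2"
  shows "(\<integral>\<^sup>+x. ennreal (real (fst x - fst (snd x))) \<partial>state_pmf n) \<le> ennreal (8 * (real K * v * L\<^sup>2 / real n))"
proof -
  let ?n = "real n"
  have npos: "0 < ?n" using n6 exp_gt_zero[of "6 / \<Delta>\<^sup>2"] by linarith
  then have expL: "exp L = ?n" by (simp add: L_def)
  have nL: "L \<le> ?n" using expL exp_ge_add_one_self[of L] by linarith
  then have n1: "20000 \<le> ?n" "1 \<le> n" using L npos by linarith+
  have K1: "1 \<le> real K" using K by simp
  have e: "0 < eps" "eps \<le> 1" "0 < eps\<^sup>2" "eps\<^sup>2 \<le> 1" using eps by (auto simp: power_le_one)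
  have L1: "1 \<le> L" "0 < L" using L by auto
  have L3: "L \<le> L ^ 3" "L\<^sup>2 \<le> L ^ 3" "1 \<le> L\<^sup>2" "1 \<le> L ^ 3"
    using L1 power_increasing[of 1 3 L] power_increasing[of 2 3 L] one_le_power[of L 2] one_le_power[of L 3] by auto
  have w: "10000 \<le> w" "10000 * L\<^sup>2 \<le> w" "10000 * L ^ 3 \<le> w" "0 < w" using wL L3 by linarith+
  have v'0: "0 \<le> v'" unfolding v'_def v'_fun_def w_def[symmetric] using e w K1 by simp
  have v24: "24 / eps\<^sup>2 * L \<le> v"
    unfolding v_def v_fun_def L_def[symmetric] v'_def[symmetric] using v'0 e K1 npos by simp
  have "1 * 1 \<le> 1 / eps\<^sup>2 * L" using e L1 by (intro mult_mono) auto
  then have v0: "24 \<le> v" using v24 by simp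
  have v_half: "v \<le> ?n / 2" "v' \<le> ?n / 2" using vv v'0 v0 by linarith+
  \<comment> \<open>The bound v' \<le> n/2 rewritten; it limits the learning time by a fraction of
    \<open>eps * n\<close> and makes the drain affordable.\<close>
  have Kw: "12 * (real K * w) \<le> eps * ?n"
  proof -
    have "6 * real K / eps * w \<le> ?n / 2" using v_half(2) unfolding v'_def v'_fun_def w_def .
    then show ?thesis using e by (simp add: field_simps)
  qed
  have Kw': "12 * (real K * w) \<le> ?n"
    using Kw mult_right_mono[OF e(2), of ?n] npos by linarith
  have "real K * 1 \<le> real K * w" using w K1 by (intro mult_left_mono) auto
  then have Kn: "real K \<le> ?n" using Kw' K1 w by linarith
  have inv_e2: "1 / eps\<^sup>2 \<le> ?n"
  proof -
    have "1 / eps\<^sup>2 * 1 \<le> 1 / eps\<^sup>2 * L" using e L1 by (intro mult_left_mono) auto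
    also have "\<dots> \<le> ?n" using v24 v_half v0 by simp
    finally show ?thesis by simp
  qed
  have inv_e: "1 / eps \<le> ?n"
  proof -
    have "1 / eps \<le> 1 / eps\<^sup>2"
      using e by (intro divide_left_mono) (auto simp: power2_eq_square mult_left_le)
    then show ?thesis using inv_e2 by linarith
  qed

  define d where "d = \<Delta> / 4"
  \<comment> \<open>Chosen so that \<open>2 * n0\<close> is (ln w / 4)^3, the exploration mass
    available by time K sqrt(w); the exponent 2/3 in w turns this cube into a square of L/\<Delta>.
    With d = \<Delta>/4 the gap cancels: \<open>n0\<close> times d^2 is L^2/512.\<close>
  define n0 where "n0 = L\<^sup>2 / (32 * \<Delta>\<^sup>2)"
  define \<eta> where "\<eta> = 2 * real K * exp (- n0 * d\<^sup>2) / d\<^sup>2"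
  define \<beta> where "\<beta> = real K * (exp (- n0 / 5) + 2 * exp (- 2 * d\<^sup>2 * n0))"
  have D2: "0 < \<Delta>\<^sup>2" "\<Delta>\<^sup>2 \<le> 1" using \<Delta> by (auto simp: power_le_one)
  have LL: "20 * L \<le> L\<^sup>2 / 512" unfolding power2_eq_square using L by simp
  have tail: "exp (- x) \<le> 1 / ?n ^ 20" if "20 * L \<le> x" for x
  proof -
    have "exp (- x) \<le> exp (- (20 * L))" using that by simp
    also have "\<dots> = 1 / exp (20 * L)" by (simp add: exp_minus inverse_eq_divide)
    also have "exp (20 * L) = exp L ^ 20" by (simp add: exp_of_nat_mult[symmetric])
    finally show ?thesis by (simp add: expL)
  qed
  have n0d: "n0 * d\<^sup>2 = L\<^sup>2 / 512" using \<Delta> by (simp add: n0_def d_def power2_eq_square)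
  have t1: "exp (- n0 * d\<^sup>2) \<le> 1 / ?n ^ 20"
    using tail[of "n0 * d\<^sup>2"] LL unfolding mult_minus_left n0d by blast
  have t2: "exp (- 2 * d\<^sup>2 * n0) \<le> 1 / ?n ^ 20"
  proof -
    have "20 * L \<le> 2 * (n0 * d\<^sup>2)" unfolding n0d using LL L by linarith
    from tail[OF this] show ?thesis by (simp add: mult_ac)
  qed
  have t3: "exp (- n0 / 5) \<le> 1 / ?n ^ 20"
  proof -
    have "L\<^sup>2 / 512 \<le> n0 / 5"
    proof -
      have "L\<^sup>2 / 512 \<le> L\<^sup>2 / (160 * \<Delta>\<^sup>2)" using D2 by (intro divide_left_mono) auto
      then show ?thesis by (simp add: n0_def)
    qed
    then show ?thesis using tail[of "n0 / 5"] LL by simp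
  qed
  \<comment> \<open>The tails are at most n^(-20) = 1/N^2. One factor 1/N absorbs K \<le> n and
    1/d^2 \<le> 24 n, the other remains.\<close>
  define N where "N = ?n ^ 10"
  have pw: "1 / ?n ^ 20 = 1 / (N * N)" by (simp add: N_def flip: power_add)
  have N0: "0 < N" using npos by (simp add: N_def)
  have n10: "?n * ?n * 48 \<le> ?n ^ 10" "?n * 3 \<le> ?n ^ 10" "?n ^ 4 \<le> ?n ^ 10"
  proof -
    have "?n * ?n * 48 \<le> ?n * ?n * ?n" using n1 by (intro mult_left_mono) auto
    also have "\<dots> = ?n ^ 3" by (simp add: power3_eq_cube)
    also have "\<dots> \<le> ?n ^ 10" using n1 by (intro power_increasing) auto
    finally show "?n * ?n * 48 \<le> ?n ^ 10" .
    have "?n * 3 \<le> ?n * ?n" using n1 by (intro mult_left_mono) auto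
    also have "\<dots> = ?n ^ 2" by (simp add: power2_eq_square)
    also have "\<dots> \<le> ?n ^ 10" using n1 by (intro power_increasing) auto
    finally show "?n * 3 \<le> ?n ^ 10" .
    show "?n ^ 4 \<le> ?n ^ 10" using n1 by (intro power_increasing) auto
  qed
  note n10 = n10[folded N_def] and t1 = t1[unfolded pw] and t2 = t2[unfolded pw] and t3 = t3[unfolded pw]
  have \<beta>: "\<beta> \<le> 1 / N"
  proof -
    have "\<beta> \<le> ?n * (3 * (1 / (N * N)))"
      unfolding \<beta>_def using Kn t2 t3 npos N0 by (intro mult_mono) auto
    also have "\<dots> = (?n * 3) / (N * N)" by simp
    also have "\<dots> \<le> N / (N * N)" using N0 n10 by (intro divide_right_mono) auto
    also have "\<dots> = 1 / N" using N0 by simp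
    finally show ?thesis .
  qed
  have \<eta>: "\<eta> \<le> 1 / N"
  proof -
    have "6 / \<Delta>\<^sup>2 \<le> L"
      using n6 npos ln_le_cancel_iff[of "exp (6 / \<Delta>\<^sup>2)" ?n] by (simp add: L_def)
    then have "1 / d\<^sup>2 \<le> 24 * L" using D2 L1 by (simp add: d_def power_divide field_simps)
    also have "\<dots> \<le> 24 * ?n" using nL by simp
    finally have d2: "1 / d\<^sup>2 \<le> 24 * ?n" .
    have "\<eta> = 2 * real K * exp (- n0 * d\<^sup>2) * (1 / d\<^sup>2)" by (simp add: \<eta>_def)
    also have "\<dots> \<le> (2 * ?n * (1 / (N * N))) * (24 * ?n)"
      using Kn t1 npos d2 N0 by (intro mult_mono) auto
    also have "\<dots> = (?n * ?n * 48) / (N * N)" by simp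
    also have "\<dots> \<le> N / (N * N)" using N0 n10 by (intro divide_right_mono) auto
    also have "\<dots> = 1 / N" using N0 by simp
    finally show ?thesis .
  qed
  have \<eta>0: "0 \<le> \<eta>" "0 \<le> \<beta>" by (auto simp: \<eta>_def \<beta>_def)

  \<comment> \<open>The fourth root makes ln a at least ln w / 4, while g = K a^2 is at most 4 K
    sqrt(w), well below K w / 4.\<close>
  define a where "a = nat \<lceil>w powr (1 / 4)\<rceil>"
  have w4: "1 \<le> w powr (1 / 4)" using w by (intro ge_one_powr_ge_zero) auto
  have a1: "w powr (1 / 4) \<le> real a" "real a \<le> w powr (1 / 4) + 1" "1 \<le> a"
    using w4 unfolding a_def by linarith+
  define g where "g = K * a\<^sup>2"
  have g1: "1 \<le> g" using K a1 by (simp add: g_def)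
  have lnw: "ln w = (2 * L / \<Delta>) powr (2 / 3)" by (simp add: w_def w_fun_def L_def)
  have pulls: "2 * n0 \<le> (\<Sum>i=1..g. explore_prob K i / real K)"
  proof -
    have "2 * n0 = ((2 * L / \<Delta>) powr (2 / 3) / 4) ^ 3"
    proof -
      have "((2 * L / \<Delta>) powr (2 / 3)) ^ 3 = (2 * L / \<Delta>) powr (2 / 3 * real 3)"
        using L1 \<Delta> by (subst powr_realpow[symmetric]) (auto simp: powr_powr)
      also have "\<dots> = (2 * L / \<Delta>) ^ 2"
        using L1 \<Delta> powr_realpow[of "2 * L / \<Delta>" 2] by simp
      finally show ?thesis by (simp add: power_divide n0_def power_mult_distrib)
    qed
    also have "\<dots> \<le> (ln (real a)) ^ 3"
    proof (rule power_mono)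
      have "ln w / 4 = ln (w powr (1 / 4))" using w by (simp add: ln_powr)
      also have "\<dots> \<le> ln (real a)" using a1 w4 by (subst ln_le_cancel_iff) auto
      finally show "(2 * L / \<Delta>) powr (2 / 3) / 4 \<le> ln (real a)" by (simp add: lnw)
    qed simp
    also have "\<dots> \<le> (\<Sum>i=1..g. explore_prob K i / real K)"
      unfolding g_def by (rule explore_sum_ge[OF K a1(3)])
    finally show ?thesis .
  qed
  have gw: "real g \<le> real K * w / 4"
  proof -
    have "real a \<le> 2 * w powr (1 / 4)" using a1 w4 by linarith
    then have "(real a)\<^sup>2 \<le> (2 * w powr (1 / 4))\<^sup>2" by (intro power_mono) auto
    also have "\<dots> = 4 * sqrt w"
      using w by (simp add: power_mult_distrib powr_half_sqrt[symmetric] powr_realpow[symmetric] powr_powr)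
    also have "\<dots> \<le> w / 4"
    proof -
      have "16 \<le> sqrt w" using w by (intro real_le_rsqrt) auto
      then have "16 * sqrt w \<le> sqrt w * sqrt w" by (intro mult_right_mono) (use w in auto)
      also have "sqrt w * sqrt w = w" using w by simp
      finally show ?thesis by simp
    qed
    finally have "real K * (real a)\<^sup>2 \<le> real K * (w / 4)" by (intro mult_left_mono) auto
    then show ?thesis by (simp add: g_def)
  qed
  \<comment> \<open>Any fixed fraction of \<open>n\<close> makes exploration rarer than a multiple
    of K L^2 / n, hence than eps/16; a quarter leaves room for draining before
    \<open>\<tau>\<close>.\<close>
  define h where "h = nat \<lceil>?n / 4\<rceil>"
  have h: "?n / 4 \<le> real h" "real h \<le> ?n / 4 + 1" unfolding h_def using npos by linarith+
  \<comment> \<open>Length of the final window. At rate eps^2/2 it yields exp(-6 L) = n^(-6), and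
    even rounded up it is below the first term of \<open>v\<close>.\<close>
  define m where "m = nat \<lceil>12 * L / eps\<^sup>2\<rceil>"
  have "0 \<le> 12 * L / eps\<^sup>2" using L1 e by simp
  then have m: "12 * L / eps\<^sup>2 \<le> real m" "real m \<le> 12 * L / eps\<^sup>2 + 1"
    unfolding m_def by linarith+
  have mv: "real m \<le> v"
  proof -
    have "1 * 1 \<le> (1 / eps\<^sup>2) * L" using e L1 by (intro mult_mono) auto
    then show ?thesis using m v24 by simp
  qed
  have mn: "m \<le> n" using mv v_half npos by linarith
  define \<tau> where "\<tau> = n - m"
  have \<tau>: "real \<tau> = ?n - real m" using mn by (simp add: \<tau>_def)
  have \<tau>half: "?n / 2 \<le> real \<tau>" using \<tau> mv v_half by linarith
  have gh: "g \<le> h" using gw Kw' h(1) npos by linarith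
  have h\<tau>: "h \<le> \<tau>" using h \<tau>half n1 by linarith
  \<comment> \<open>3 K L^2 times a harmonic sum of at most 2 L gives 6 K L^3; the last unit covers
    all the \<open>\<eta>\<close> terms.\<close>
  define P where "P = 7 * real K * L ^ 3"
  have P: "(\<Sum>i\<in>{g<..h}. explore_prob K i + \<eta>) \<le> P"
  proof -
    have hn: "h \<le> n" using h\<tau> \<tau>_def by simp
    have "(\<Sum>i\<in>{g<..h}. explore_prob K i + \<eta>) \<le> (\<Sum>i=1..n. explore_prob K i + \<eta>)"
      using hn \<eta>0 by (intro sum_mono2) (auto simp: explore_prob_def)
    also have "\<dots> \<le> (\<Sum>i=1..n. 3 * real K * L\<^sup>2 * (1 / real i) + \<eta>)"
      unfolding L_def by (intro sum_mono add_right_mono explore_prob_le) auto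
    also have "\<dots> = 3 * real K * L\<^sup>2 * (\<Sum>i=1..n. 1 / real i) + ?n * \<eta>"
      by (simp only: sum.distrib sum_distrib_left[symmetric]) simp
    also have "\<dots> \<le> 3 * real K * L\<^sup>2 * (2 * L) + 1"
    proof (rule add_mono)
      have "(\<Sum>i=1..n. 1 / real i) \<le> 2 * L" using sum_inverse_le_ln[OF n1(2)] L1 by (simp add: L_def)
      then show "3 * real K * L\<^sup>2 * (\<Sum>i=1..n. 1 / real i) \<le> 3 * real K * L\<^sup>2 * (2 * L)"
        using K1 by (intro mult_left_mono) auto
      have "?n * \<eta> \<le> ?n * (1 / N)" using \<eta> npos by (intro mult_left_mono) auto
      also have "\<dots> \<le> 1" using n10(2) N0 npos by (simp add: divide_le_eq)
      finally show "?n * \<eta> \<le> 1" .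
    qed
    also have "\<dots> \<le> P"
    proof -
      have "1 * 1 \<le> real K * L ^ 3" using K1 L3 by (intro mult_mono) auto
      moreover have "3 * real K * L\<^sup>2 * (2 * L) = 6 * (real K * L ^ 3)" by (simp add: power2_eq_square power3_eq_cube)
      ultimately show ?thesis unfolding P_def by linarith
    qed
    finally show ?thesis .
  qed
  have small: "explore_prob K s + \<eta> \<le> eps / 8" if "h < s" "s \<le> n" for s
  proof -
    have s: "?n / 4 \<le> real s" "1 \<le> s" using h that by linarith+
    have "explore_prob K s \<le> 3 * real K * L\<^sup>2 * (1 / real s)"
      unfolding L_def by (rule explore_prob_le) (use s that in auto)
    also have "\<dots> \<le> 3 * real K * L\<^sup>2 * (1 / (?n / 4))"
      using s npos K1 by (intro mult_left_mono divide_left_mono) auto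
    also have "\<dots> = 12 * real K * L\<^sup>2 / ?n" by simp
    also have "\<dots> \<le> eps / 16"
    proof -
      have "192 * (real K * L\<^sup>2) = real K * (192 * L\<^sup>2)" by simp
      also have "\<dots> \<le> real K * w" using w L3 by (intro mult_left_mono) auto
      also have "\<dots> \<le> eps * ?n" using Kw mult_nonneg_nonneg[of "real K" w] w by linarith
      finally show ?thesis using npos by (simp add: field_simps)
    qed
    finally have 1: "explore_prob K s \<le> eps / 16" .
    have "\<eta> \<le> eps / 16"
    proof -
      have "16 * ?n \<le> ?n * ?n * 48" using n1 by simp
      then have "16 * (1 / eps) \<le> N" using n10(1) inv_e by linarith
      then have "1 / N \<le> eps / 16" using e N0 by (simp add: field_simps)
      then show ?thesis using \<eta> by linarith
    qed
    then show ?thesis using 1 by linarith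
  qed
  have gap': "\<mu> k + 4 * d \<le> \<mu> ks" if "k \<in> {1..K}" "k \<noteq> ks" for k
    using gap[OF that] by (simp add: d_def)
  have d01: "0 < d" "d \<le> 1" using \<Delta> by (auto simp: d_def)
  have n00: "0 < n0" using L1 D2 by (simp add: n0_def)
  note main = regret_bound[OF d01 n00 gap' g1 gh h\<tau> _ pulls P[unfolded \<eta>_def] small[unfolded \<eta>_def], folded \<eta>_def \<beta>_def]

  have win: "exp (- (eps\<^sup>2 / 2) * real (n - \<tau>)) \<le> 1 / ?n ^ 6"
  proof -
    have "6 * L \<le> eps\<^sup>2 / 2 * real m" using m(1) e by (simp add: field_simps)
    moreover have "n - \<tau> = m" using mn by (simp add: \<tau>_def)
    ultimately have "exp (- (eps\<^sup>2 / 2) * real (n - \<tau>)) \<le> exp (- (6 * L))" by simp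
    also have "\<dots> = 1 / exp (6 * L)" by (simp add: exp_minus inverse_eq_divide)
    also have "exp (6 * L) = exp L ^ 6" by (simp add: exp_of_nat_mult[symmetric])
    finally show ?thesis by (simp add: expL)
  qed
  \<comment> \<open>Exponents in units of eps K w: the drain contributes at least 12/10, while
    exploration and the learning phase cost at most 1/4 each. The factor left over, 8/eps^2 + 3 n,
    is at most 11 n.\<close>
  have drain: "exp (- (eps\<^sup>2 / 2) * real (\<tau> - h)) * (exp (2 * eps * P) * (exp (eps * real g) * (8 / eps\<^sup>2) + 3 * ?n)) \<le> 11 * ?n"
  proof -
    have th: "?n / 5 \<le> real (\<tau> - h)" using \<tau>half h h\<tau> n1 by (simp add: of_nat_diff)
    have "eps\<^sup>2 / 2 * (?n / 5) \<le> eps\<^sup>2 / 2 * real (\<tau> - h)"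
      using th e by (intro mult_left_mono) auto
    moreover have "eps\<^sup>2 / 2 * (?n / 5) = eps / 10 * (eps * ?n)" by (simp add: power2_eq_square)
    moreover have "eps / 10 * (12 * (real K * w)) \<le> eps / 10 * (eps * ?n)"
      using Kw e by (intro mult_left_mono) auto
    moreover have "eps / 10 * (12 * (real K * w)) = 12 / 10 * (eps * (real K * w))" by simp
    moreover have "2 * eps * P \<le> 1 / 4 * (eps * (real K * w))"
    proof -
      have "eps * real K * (56 * L ^ 3) \<le> eps * real K * w"
        using w(3) e L3 by (intro mult_left_mono) auto
      moreover have "2 * eps * P = 14 * (eps * real K * L ^ 3)" by (simp add: P_def)
      ultimately show ?thesis by (simp add: mult.assoc)
    qed
    moreover have "eps * real g \<le> 1 / 4 * (eps * (real K * w))"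
      using mult_left_mono[OF gw, of eps] e by simp
    moreover have "0 \<le> eps * (real K * w)" using e w by simp
    ultimately have ex: "- (eps\<^sup>2 / 2) * real (\<tau> - h) + (2 * eps * P + eps * real g) \<le> 0" by linarith
    have "1 \<le> exp (eps * real g)" using e by simp
    then have "exp (eps * real g) * (8 / eps\<^sup>2) + 1 * (3 * ?n) \<le> exp (eps * real g) * (8 / eps\<^sup>2) + exp (eps * real g) * (3 * ?n)"
      using npos by (intro add_left_mono mult_right_mono) auto
    also have "\<dots> = exp (eps * real g) * (8 / eps\<^sup>2 + 3 * ?n)" by (simp only: distrib_left)
    finally have "exp (- (eps\<^sup>2 / 2) * real (\<tau> - h)) * (exp (2 * eps * P) * (exp (eps * real g) * (8 / eps\<^sup>2) + 3 * ?n))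
       \<le> exp (- (eps\<^sup>2 / 2) * real (\<tau> - h)) * (exp (2 * eps * P) * (exp (eps * real g) * (8 / eps\<^sup>2 + 3 * ?n)))"
      by (intro mult_left_mono) auto
    also have "\<dots> = exp (- (eps\<^sup>2 / 2) * real (\<tau> - h) + (2 * eps * P + eps * real g)) * (8 / eps\<^sup>2 + 3 * ?n)"
      by (simp only: exp_add mult.assoc)
    also have "\<dots> \<le> 1 * (8 / eps\<^sup>2 + 3 * ?n)"
      using ex npos e by (intro mult_right_mono) auto
    also have "\<dots> \<le> 11 * ?n" using inv_e2 by simp
    finally show ?thesis .
  qed
  \<comment> \<open>All slots of the window lie beyond n/2, so exploration contributes at most 6 K
    L^2 / n per slot; \<open>\<eta>\<close> and \<open>\<beta>\<close> together add at most one more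
    such unit.\<close>
  have window: "(\<Sum>s\<in>{\<tau><..n}. explore_prob K s + \<eta> + \<beta>) \<le> v * (7 * (real K * L\<^sup>2 / ?n))"
  proof -
    have KL: "1 * 1 \<le> real K * L\<^sup>2" using K1 L3 by (intro mult_mono) auto
    have "explore_prob K s + \<eta> + \<beta> \<le> 7 * (real K * L\<^sup>2 / ?n)" if "s \<in> {\<tau><..n}" for s
    proof -
      have s: "?n / 2 \<le> real s" "1 \<le> s" using \<tau>half that by auto
      have "explore_prob K s \<le> 3 * real K * L\<^sup>2 * (1 / real s)"
        unfolding L_def by (rule explore_prob_le) (use s that in auto)
      also have "\<dots> \<le> 3 * real K * L\<^sup>2 * (1 / (?n / 2))"
        using s npos K1 by (intro mult_left_mono divide_left_mono) auto
      also have "\<dots> = 6 * (real K * L\<^sup>2 / ?n)" by simp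
      finally have 1: "explore_prob K s \<le> 6 * (real K * L\<^sup>2 / ?n)" .
      have "1 / N + 1 / N = 2 / N" by simp
      also have "\<dots> \<le> 1 / ?n" using n10(2) npos N0 by (simp add: field_simps)
      also have "\<dots> \<le> real K * L\<^sup>2 / ?n" using KL npos by (simp add: divide_right_mono)
      finally have "\<eta> + \<beta> \<le> real K * L\<^sup>2 / ?n" using \<eta> \<beta> by linarith
      with 1 have "explore_prob K s + (\<eta> + \<beta>) \<le> 6 * (real K * L\<^sup>2 / ?n) + real K * L\<^sup>2 / ?n"
        by (rule add_mono)
      then show ?thesis by (simp add: add.assoc)
    qed
    then have "(\<Sum>s\<in>{\<tau><..n}. explore_prob K s + \<eta> + \<beta>) \<le> (\<Sum>s\<in>{\<tau><..n}. 7 * (real K * L\<^sup>2 / ?n))"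
      by (rule sum_mono)
    also have "\<dots> = real m * (7 * (real K * L\<^sup>2 / ?n))" using mn by (simp add: \<tau>_def)
    also have "\<dots> \<le> v * (7 * (real K * L\<^sup>2 / ?n))" using mv npos by (intro mult_right_mono) auto
    finally show ?thesis .
  qed
  \<comment> \<open>The contribution of paths that are bad or never idle: at most 14/n^4 + n^2/N,
    hence below 1/n. It supplies the remaining unit of the constant 8.\<close>
  have "real n * (exp (- (eps\<^sup>2 / 2) * real (n - \<tau>)) * (exp (- (eps\<^sup>2 / 2) * real (\<tau> - h)) *
        (exp (2 * eps * P) * (exp (eps * real g) * (8 / eps\<^sup>2) + 3 * real n)) + 3 * real n) + real n * \<beta>)
     \<le> ?n * (1 / ?n ^ 6 * (11 * ?n + 3 * ?n) + ?n * (1 / N))"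
  proof -
    have "?n * (E * (X + 3 * ?n) + ?n * \<beta>) \<le> ?n * (1 / ?n ^ 6 * (11 * ?n + 3 * ?n) + ?n * (1 / N))"
      if "E \<le> 1 / ?n ^ 6" "X \<le> 11 * ?n" "0 \<le> X" for E X
      using that \<beta> npos by (intro mult_left_mono add_mono mult_mono) auto
    from this[OF win drain] show ?thesis using npos by simp
  qed
  also have "\<dots> = 14 / ?n ^ 4 + ?n * ?n * (1 / N)"
    using npos by (simp add: field_simps eval_nat_numeral)
  also have "\<dots> \<le> 1 / ?n"
  proof -
    have "14 / ?n ^ 4 \<le> 14 / ?n ^ 2" using n1 by (intro divide_left_mono power_increasing) auto
    moreover have "?n * ?n * (1 / N) \<le> ?n * ?n * (1 / ?n ^ 4)"
      using n10(3) npos N0 by (intro mult_left_mono divide_left_mono) auto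
    moreover have "?n * ?n * (1 / ?n ^ 4) = 1 / ?n ^ 2" using npos by (simp add: field_simps eval_nat_numeral)
    moreover have "15 / ?n ^ 2 \<le> 1 / ?n" using n1 by (simp add: field_simps power2_eq_square)
    ultimately show ?thesis by linarith
  qed
  also have "\<dots> \<le> v * (real K * L\<^sup>2 / ?n)"
  proof -
    have "1 * 1 \<le> real K * L\<^sup>2" using K1 L3 by (intro mult_mono) auto
    then have "1 / ?n \<le> real K * L\<^sup>2 / ?n" using npos by (intro divide_right_mono) auto
    then have "1 * (1 / ?n) \<le> v * (real K * L\<^sup>2 / ?n)" using v0 npos by (intro mult_mono) auto
    then show ?thesis by simp
  qed
  finally have "real n * (exp (- (eps\<^sup>2 / 2) * real (n - \<tau>)) * (exp (- (eps\<^sup>2 / 2) * real (\<tau> - h)) *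
        (exp (2 * eps * P) * (exp (eps * real g) * (8 / eps\<^sup>2) + 3 * real n)) + 3 * real n) + real n * \<beta>)
      + (\<Sum>s\<in>{\<tau><..n}. explore_prob K s + \<eta> + \<beta>)
      \<le> v * (real K * L\<^sup>2 / ?n) + v * (7 * (real K * L\<^sup>2 / ?n))"
    by (intro add_mono window)
  also have "\<dots> = 8 * (real K * v * L\<^sup>2 / ?n)" by simp
  finally have tot: "real n * (exp (- (eps\<^sup>2 / 2) * real (n - \<tau>)) * (exp (- (eps\<^sup>2 / 2) * real (\<tau> - h)) *
        (exp (2 * eps * P) * (exp (eps * real g) * (8 / eps\<^sup>2) + 3 * real n)) + 3 * real n) + real n * \<beta>)
      + (\<Sum>s\<in>{\<tau><..n}. explore_prob K s + \<eta> + \<beta>) \<le> 8 * (real K * v * L\<^sup>2 / ?n)" .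
  have "\<tau> \<le> n" by (simp add: \<tau>_def)
  from order_trans[OF main[OF _ _ this] ennreal_leI[OF tot]] show ?thesis by simp
qed

text \<open>Q - Q* is at most its positive part, which is bounded by \<open>n\<close> and so
  integrable. The monotonicity rule asks for integrability of this nonnegative majorant
  only.\<close>

lemma (in qths) queue_regret_le:
  assumes "(\<integral>\<^sup>+x. ennreal (real (fst x - fst (snd x))) \<partial>state_pmf n) \<le> ennreal r" "0 \<le> r"
  shows "queue_regret K lam \<mu> ks \<pi> n \<le> r"
proof -
  let ?D = "\<lambda>x :: qstate. real (fst x - fst (snd x))"
  have int: "integrable (measure_pmf (state_pmf n)) ?D"
    by (rule measure_pmf.integrable_const_bound[where B = "real n"])
      (auto simp: AE_measure_pmf_iff dest!: state_regret_le)
  have "queue_regret K lam \<mu> ks \<pi> n = (\<integral>x. real (fst x) - real (fst (snd x)) \<partial>state_pmf n)"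
    by (simp add: queue_regret_def qths_dist_eq[OF K ks])
  also have "\<dots> \<le> (\<integral>x. ?D x \<partial>state_pmf n)"
    by (rule integral_mono'[OF int]) (auto simp: of_nat_diff_real)
  also have "\<dots> \<le> r"
  proof -
    have "ennreal (\<integral>x. ?D x \<partial>state_pmf n) = (\<integral>\<^sup>+x. ennreal (?D x) \<partial>state_pmf n)"
      by (rule nn_integral_eq_integral[symmetric, OF int]) simp
    with assms(1) have "ennreal (\<integral>x. ?D x \<partial>state_pmf n) \<le> ennreal r" by (simp only:)
    then show ?thesis by (simp only: ennreal_le_iff[OF assms(2)])
  qed
  finally show ?thesis .
qed

theorem theorem2:
  "\<exists>C t0. C > 0 \<and>
     (\<forall>(K::nat) (lam::real) (\<mu>::nat \<Rightarrow> real) (kstar::nat) (\<pi>::nat pmf) (t::nat).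
        K \<ge> 2 \<longrightarrow> 0 \<le> lam \<longrightarrow> (\<forall>k\<in>{1..K}. 0 \<le> \<mu> k \<and> \<mu> k \<le> 1) \<longrightarrow>
        kstar \<in> {1..K} \<longrightarrow> (\<forall>k\<in>{1..K}. k \<noteq> kstar \<longrightarrow> \<mu> k < \<mu> kstar) \<longrightarrow>
        lam < \<mu> kstar \<longrightarrow>
        genie_stationary lam (\<mu> kstar) \<pi> \<longrightarrow>
        (let \<epsilon> = \<mu> kstar - lam;
             \<Delta> = \<mu> kstar - Max (\<mu> ` ({1..K} - {kstar}))
         in real t > t0 \<longrightarrow>
            w_fun \<Delta> (real t) / ln (real t) \<ge> 2 / \<epsilon> \<longrightarrow>
            real t \<ge> exp (6 / \<Delta>\<^sup>2) \<longrightarrow>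
            v_fun K \<epsilon> \<Delta> (real t) + v'_fun K \<epsilon> \<Delta> (real t) \<le> real t / 2 \<longrightarrow>
            queue_regret K lam \<mu> kstar \<pi> t
              \<le> C * (real K * v_fun K \<epsilon> \<Delta> (real t) * (ln (real t))\<^sup>2 / real t)))"
proof -
  \<comment> \<open>The threshold is taken for \<Delta> = 1. As \<Delta> \<le> 1 always and
    \<open>w_fun\<close> grows when \<Delta> shrinks, it serves every instance. It exists because
    exp((2 ln t)^(2/3)) outgrows every power of ln t.\<close>
  have "eventually (\<lambda>t::real. 20000 \<le> ln t) at_top" by real_asymp
  moreover have "eventually (\<lambda>t::real. 10000 * (ln t) ^ 3 \<le> exp ((2 * ln t) powr (2 / 3))) at_top"
    by real_asymp
  ultimately have "eventually (\<lambda>t::real. 20000 \<le> ln t \<and> 10000 * (ln t) ^ 3 \<le> exp ((2 * ln t) powr (2 / 3))) at_top"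
    by (rule eventually_conj)
  then obtain t0 :: real where t0: "\<And>t. t \<ge> t0 \<Longrightarrow> 20000 \<le> ln t \<and> 10000 * (ln t) ^ 3 \<le> exp ((2 * ln t) powr (2 / 3))"
    unfolding eventually_at_top_linorder by blast
  have bound: "queue_regret K lam \<mu> kstar \<pi> t \<le> 8 * (real K * v_fun K \<epsilon> \<Delta> (real t) * (ln (real t))\<^sup>2 / real t)"
    if K2: "K \<ge> 2" and lam0: "0 \<le> lam" and mu: "\<forall>k\<in>{1..K}. 0 \<le> \<mu> k \<and> \<mu> k \<le> 1"
      and ks: "kstar \<in> {1..K}" and best: "\<forall>k\<in>{1..K}. k \<noteq> kstar \<longrightarrow> \<mu> k < \<mu> kstar"
      and lam: "lam < \<mu> kstar" and stat: "genie_stationary lam (\<mu> kstar) \<pi>"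
      and \<epsilon>: "\<epsilon> = \<mu> kstar - lam" and \<Delta>_eq: "\<Delta> = \<mu> kstar - Max (\<mu> ` ({1..K} - {kstar}))"
      and t: "t0 < real t" and t6: "exp (6 / \<Delta>\<^sup>2) \<le> real t"
      and vv: "v_fun K \<epsilon> \<Delta> (real t) + v'_fun K \<epsilon> \<Delta> (real t) \<le> real t / 2"
    for K :: nat and lam :: real and \<mu> :: "nat \<Rightarrow> real" and kstar :: nat and \<pi> :: "nat pmf" and t :: nat and \<epsilon> \<Delta> :: real
  proof -
    let ?A = "\<mu> ` ({1..K} - {kstar})"
    interpret qths K lam \<mu> kstar \<pi>
      using K2 lam0 mu ks lam stat by unfold_locales auto
    \<comment> \<open>With two servers or more there is a competitor, so the maximum in \<Delta>
      ranges over a nonempty set.\<close>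
    have "(if kstar = 1 then 2 else 1) \<in> {1..K} - {kstar}" using K2 by auto
    then have ne: "?A \<noteq> {}" by blast
    have fin: "finite ?A" by simp
    from Max_in[OF fin ne] obtain j where j: "Max ?A = \<mu> j" "j \<in> {1..K} - {kstar}" by (rule imageE)
    have \<Delta>: "0 < \<Delta>" "\<Delta> \<le> 1"
      using best mu j mu_ks unfolding \<Delta>_eq by force+
    have gap: "\<mu> k + \<Delta> \<le> \<mu> kstar" if "k \<in> {1..K}" "k \<noteq> kstar" for k
    proof -
      have "\<mu> k \<le> Max ?A" using that fin by (intro Max_ge) auto
      then show ?thesis by (simp add: \<Delta>_eq)
    qed
    have L: "20000 \<le> ln (real t)" and "10000 * (ln (real t)) ^ 3 \<le> exp ((2 * ln (real t)) powr (2 / 3))"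
      using t0[of "real t"] t by auto
    note this(2)
    also have "exp ((2 * ln (real t)) powr (2 / 3)) \<le> w_fun \<Delta> (real t)"
    proof -
      have "2 * ln (real t) / 1 \<le> 2 * ln (real t) / \<Delta>"
        using \<Delta> L by (intro divide_left_mono) auto
      then have "(2 * ln (real t)) powr (2 / 3) \<le> (2 * ln (real t) / \<Delta>) powr (2 / 3)"
        using L by (intro powr_mono2) auto
      then show ?thesis by (simp add: w_fun_def)
    qed
    finally have w: "10000 * (ln (real t)) ^ 3 \<le> w_fun \<Delta> (real t)" .
    have "0 \<le> v_fun K \<epsilon> \<Delta> (real t)"
      using eps L unfolding \<epsilon> by (simp add: v_fun_def v'_fun_def w_fun_def)
    then have "0 \<le> 8 * (real K * v_fun K \<epsilon> \<Delta> (real t) * (ln (real t))\<^sup>2 / real t)"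
      by simp
    then show ?thesis
      unfolding \<epsilon> by (intro queue_regret_le regret_le[OF gap \<Delta> L w t6 vv[unfolded \<epsilon>]])
  qed
  show ?thesis
    unfolding Let_def
    by (rule exI[of _ 8], rule exI[of _ t0], intro conjI allI impI, simp, rule bound; (rule refl | assumption))
qed

end
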